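(* Let $T$ be an invertible block TBT-matrix, and let $\widehat u(\lambda)=\begin{bmatrix}\widehat u_1(\lambda) \\ \widehat u_2(\lambda)\end{bmatrix}$, $G(\lambda)$ and $K$ be associated with $T$ as in the context. Then $$\widehat u(\lambda)=G(\lambda)^{-1}\,\mathrm{col}\begin{bmatrix}0&\mathbf 1_{m_2}\otimes I_{m_3}&0&\mathbf 1_{m_1}\otimes I_{m_3}\end{bmatrix}\theta(\lambda),$$ $$\theta(\lambda):=\mathrm i\Big(I_{m_3}+KR\Big(\prod_{i=1}^2(A_i-\lambda_iI)^{-1}\Big)\mathcal L\Big),$$ for all $\lambda=(\lambda_1,\lambda_2)\in\mathbb C^2$ with $\lambda_1,\lambda_2\ne\mathrm i/2$ and $\det G(\lambda)\neq0$. Here the two zero blocks have sizes $m_2m_3\times m_3$ and $m_1m_3\times m_3$, respectively.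
   Context: Notation: $I_r$ is the $r\times r$ identity, $I=I_m$; $\otimes$ is the Kronecker product; ${}^*$ is the conjugate transpose; $\mathrm{col}[\dots]$ stacks blocks into a (block) column; $\mathbf 1_r$ is the $r\times1$ column of ones. Fix integers $m_1,m_2,m_3\ge2$ and put $m=m_1m_2m_3$. A block TBT-matrix is an $m\times m$ matrix $T=\{\mathcal T_{i-k}\}_{i,k=1}^{m_1}$, where $\mathcal T_r=\{t^{(r)}_{i-k}\}_{i,k=1}^{m_2}$ and the $t^{(r)}_s$ are complex $m_3\times m_3$ blocks. Let $\mathcal A_p=\{a_{j-\ell}\}_{j,\ell=1}^{m_p}$ with $a_r=0$ for $r<0$, $a_0=\mathrm i/2$, $a_r=\mathrm i$ for $r>0$, and $A_1=\mathcal A_1\otimes I_{m_2}\otimes I_{m_3}$, $A_2=I_{m_1}\otimes\mathcal A_2\otimes I_{m_3}$ (these commute). Let $\mathcal L=\mathbf 1_{m_1m_2}\otimes I_{m_3}$ and $\mathcal L_p=\mathbf 1_{m_p}\otimes I_{m_3}$ $(p=1,2)$. Define $M_{11}=\mathrm{col}[M_{11}^{(1)},\dots,M_{11}^{(m_1)}]$, $M_{11}^{(i)}=\tfrac12\mathcal T_0+\sum_{s=1}^{i-1}\mathcal T_s$; $M_{21}=\mathbf 1_{m_1}^*\otimes I_{m_2m_3}$; $M_{31}=M_{21}^*$; $M_{41}=[M_{41}^{(1)}\ \dots\ M_{41}^{(m_1)}]$, $M_{41}^{(k)}=\tfrac12\mathcal T_0+\sum_{s=1}^{k-1}\mathcal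 T_{-s}$; $M_{12}=\{M_{12}^{(i-k)}\}_{i,k=1}^{m_1}$, where $M_{12}^{(r)}$ is the block column with $i$-th block $\tfrac12t_0^{(r)}+\sum_{j=1}^{i-1}t_j^{(r)}$ $(1\le i\le m_2)$; $M_{22}=I_{m_1}\otimes\mathbf 1_{m_2}^*\otimes I_{m_3}$; $M_{32}=M_{22}^*$; $M_{42}=\{M_{42}^{(i-k)}\}_{i,k=1}^{m_1}$, where $M_{42}^{(r)}$ is the block row with $k$-th block $\tfrac12t_0^{(r)}+\sum_{\ell=1}^{k-1}t_{-\ell}^{(r)}$ $(1\le k\le m_2)$. For invertible $T$ and $p=1,2$ put $R=T^{-1}$, $\Pi_p=[M_{1p}\ M_{3p}]$, $\widehat\Pi_p=\begin{bmatrix}M_{2p} \\ M_{4p}\end{bmatrix}$, $\Gamma_p=R\Pi_p$, $\widehat\Gamma_p=\widehat\Pi_pR$. For $\{k,p\}=\{1,2\}$ define $$\widehat v_p(\lambda)=\widehat\Gamma_p\Big(\prod_{i=1}^2(A_i-\lambda_iI)^{-1}\Big)\mathcal L,\qquad \widehat u_p(\lambda)=\widehat v_p(\lambda)+\mathrm i\begin{bmatrix}0 \\ I_{m_km_3}\end{bmatrix}\big((\mathcal A_k-\lambda_kI_{m_k})^{-1}\mathbf 1_{m_k}\otimes I_{m_3}\big),$$ with zero block square of order $m_km_3$. Define further $K_{11}$ = block column with $i$-th block $\tfrac12M_{42}^{(0)}+\sum_{j=1}^{i-1}M_{42}^{(j)}$ $(1\le i\le m_1)$; $K_{12}$ = block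 row with $k$-th block $\tfrac12M_{12}^{(0)}+\sum_{j=1}^{k-1}M_{12}^{(-j)}$ $(1\le k\le m_1)$; $K$ = block row with $k$-th block $\tfrac12M_{42}^{(0)}+\sum_{j=1}^{k-1}M_{42}^{(-j)}$ $(1\le k\le m_1)$. The $2(m_1+m_2)m_3\times2(m_1+m_2)m_3$ matrix function $G$ is $$G(\lambda)=\begin{bmatrix}G_{11}(\lambda_2)&G_{12} \\ G_{21}&G_{22}(\lambda_1)\end{bmatrix},$$ $$G_{11}(\lambda_2)=\begin{bmatrix}(\mathcal A_2-\lambda_2I_{m_2})\otimes I_{m_3}&0 \\ 0&(\mathcal A_2-\lambda_2I_{m_2})\otimes I_{m_3}\end{bmatrix},\quad G_{22}(\lambda_1)=\begin{bmatrix}(\mathcal A_1-\lambda_1I_{m_1})\otimes I_{m_3}&0 \\ 0&(\mathcal A_1-\lambda_1I_{m_1})\otimes I_{m_3}\end{bmatrix},$$ $$G_{21}=\mathrm i\left(\widehat\Pi_2\Gamma_1-\begin{bmatrix}\mathcal L_1\mathcal L_2^*&0 \\ K_{11}&0\end{bmatrix}\right),\qquad G_{12}=\mathrm i\left(\widehat\Pi_1\Gamma_2-\begin{bmatrix}\mathcal L_2\mathcal L_1^*&0 \\ K_{12}&0\end{bmatrix}\right).$$ ($\det G(\lambda)$ is a polynomial in $\lambda_1,\lambda_2$ that is not identically zero, so $G(\lambda)^{-1}$ is a rational matrix function.) *)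

theory Defs
  imports
    Complex_Main
    "Jordan_Normal_Form.Gauss_Jordan_Elimination"
    "Jordan_Normal_Form.Determinant"
    "Jordan_Normal_Form.Schur_Decomposition"
begin

section \<open>Matrix operations\<close>

text \<open>Indices of blocks and of entries start at 0 throughout, so the index \<open>i\<close> below corresponds
  to the customary 1-based index \<open>i + 1\<close>; Toeplitz indices \<open>i - k\<close> are unaffected by the shift.\<close>

definition kron :: "complex mat \<Rightarrow> complex mat \<Rightarrow> complex mat"  (infixl \<open>\<otimes>\<^sub>K\<close> 75) where
  "A \<otimes>\<^sub>K B = mat (dim_row A * dim_row B) (dim_col A * dim_col B)
     (\<lambda>(i, j). A $$ (i div dim_row B, j div dim_col B) * B $$ (i mod dim_row B, j mod dim_col B))"

text \<open>The \<open>p \<times> q\<close> block matrix whose blocks \<open>B i k\<close> all have size \<open>r \<times> c\<close>.\<close>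

definition block_mat :: "nat \<Rightarrow> nat \<Rightarrow> nat \<Rightarrow> nat \<Rightarrow> (nat \<Rightarrow> nat \<Rightarrow> complex mat) \<Rightarrow> complex mat" where
  "block_mat p q r c B = mat (p * r) (q * c)
     (\<lambda>(i, j). B (i div r) (j div c) $$ (i mod r, j mod c))"

abbreviation block_col :: "nat \<Rightarrow> nat \<Rightarrow> nat \<Rightarrow> (nat \<Rightarrow> complex mat) \<Rightarrow> complex mat" where
  "block_col p r c B \<equiv> block_mat p 1 r c (\<lambda>i _. B i)"

abbreviation block_row :: "nat \<Rightarrow> nat \<Rightarrow> nat \<Rightarrow> (nat \<Rightarrow> complex mat) \<Rightarrow> complex mat" where
  "block_row q r c B \<equiv> block_mat 1 q r c (\<lambda>_ k. B k)"

text \<open>The block Toeplitz matrix with the \<open>r \<times> c\<close> block \<open>B (i - k)\<close> at position \<open>(i, k)\<close>.\<close>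

definition toeplitz :: "nat \<Rightarrow> nat \<Rightarrow> nat \<Rightarrow> (int \<Rightarrow> complex mat) \<Rightarrow> complex mat" where
  "toeplitz n r c B = block_mat n n r c (\<lambda>i k. B (int i - int k))"

definition append_cols :: "complex mat \<Rightarrow> complex mat \<Rightarrow> complex mat"  (infixr \<open>@\<^sub>c\<close> 65) where
  "A @\<^sub>c B = four_block_mat A B (0\<^sub>m 0 (dim_col A)) (0\<^sub>m 0 (dim_col B))"

definition ones :: "nat \<Rightarrow> complex mat" where
  "ones n = mat n 1 (\<lambda>_. 1)"

text \<open>The library's \<open>mat_inverse\<close> is \<open>None\<close> on singular matrices.\<close>

definition minv :: "complex mat \<Rightarrow> complex mat" where
  "minv A = the (mat_inverse A)"

lemma minv:
  assumes A: "A \<in> carrier_mat n n" and det: "det A \<noteq> 0"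
  shows "A * minv A = 1\<^sub>m n \<and> minv A * A = 1\<^sub>m n \<and> minv A \<in> carrier_mat n n"
proof (cases "mat_inverse A")
  case None
  then show ?thesis
    using mat_inverse(1)[OF A, of "()"] det_non_zero_imp_unit[OF A det, of "()"] by simp
next
  case (Some B)
  then show ?thesis using mat_inverse(2)[OF A] by (simp add: minv_def)
qed

text \<open>\<open>half_sum F i\<close> is \<open>F 0 / 2 + F 1 + \<dots> + F i\<close>, for matrices \<open>F s\<close> of equal size.\<close>

definition half_sum :: "(int \<Rightarrow> complex mat) \<Rightarrow> nat \<Rightarrow> complex mat" where
  "half_sum F i = mat (dim_row (F 0)) (dim_col (F 0))
     (\<lambda>ab. F 0 $$ ab / 2 + (\<Sum>s = 1..i. F (int s) $$ ab))"

section \<open>Block TBT-matrices\<close>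

text \<open>\<open>t r s\<close> is the \<open>m3 \<times> m3\<close> block with outer Toeplitz index \<open>r\<close> and inner Toeplitz index \<open>s\<close>;
  only \<open>\<bar>r\<bar> < m1\<close> and \<open>\<bar>s\<bar> < m2\<close> matter.\<close>

definition TBT_block :: "nat \<Rightarrow> nat \<Rightarrow> (int \<Rightarrow> int \<Rightarrow> complex mat) \<Rightarrow> int \<Rightarrow> complex mat" where
  "TBT_block m2 m3 t r = toeplitz m2 m3 m3 (t r)"

definition TBT :: "nat \<Rightarrow> nat \<Rightarrow> nat \<Rightarrow> (int \<Rightarrow> int \<Rightarrow> complex mat) \<Rightarrow> complex mat" where
  "TBT m1 m2 m3 t = toeplitz m1 (m2 * m3) (m2 * m3) (TBT_block m2 m3 t)"

definition calA :: "nat \<Rightarrow> complex mat" where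
  "calA n = mat n n (\<lambda>(j, l). if j < l then 0 else if j = l then \<i> / 2 else \<i>)"

definition A1 :: "nat \<Rightarrow> nat \<Rightarrow> nat \<Rightarrow> complex mat" where
  "A1 m1 m2 m3 = calA m1 \<otimes>\<^sub>K 1\<^sub>m m2 \<otimes>\<^sub>K 1\<^sub>m m3"

definition A2 :: "nat \<Rightarrow> nat \<Rightarrow> nat \<Rightarrow> complex mat" where
  "A2 m1 m2 m3 = 1\<^sub>m m1 \<otimes>\<^sub>K calA m2 \<otimes>\<^sub>K 1\<^sub>m m3"

text \<open>\<open>Lcol n m3\<close> is \<open>\<L>\<close> for \<open>n = m1 * m2\<close> and \<open>\<L>\<^sub>p\<close> for \<open>n = m\<^sub>p\<close>.\<close>

definition Lcol :: "nat \<Rightarrow> nat \<Rightarrow> complex mat" where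
  "Lcol n m3 = ones n \<otimes>\<^sub>K 1\<^sub>m m3"

definition M11 where
  "M11 m1 m2 m3 t = block_col m1 (m2 * m3) (m2 * m3) (\<lambda>i. half_sum (TBT_block m2 m3 t) i)"

definition M21 where
  "M21 m1 m2 m3 = mat_adjoint (ones m1) \<otimes>\<^sub>K 1\<^sub>m (m2 * m3)"

definition M31 where
  "M31 m1 m2 m3 = mat_adjoint (M21 m1 m2 m3)"

definition M41 where
  "M41 m1 m2 m3 t =
     block_row m1 (m2 * m3) (m2 * m3) (\<lambda>k. half_sum (\<lambda>s. TBT_block m2 m3 t (- s)) k)"

definition M12_block :: "nat \<Rightarrow> nat \<Rightarrow> (int \<Rightarrow> int \<Rightarrow> complex mat) \<Rightarrow> int \<Rightarrow> complex mat" where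
  "M12_block m2 m3 t r = block_col m2 m3 m3 (\<lambda>i. half_sum (t r) i)"

definition M12 where
  "M12 m1 m2 m3 t = toeplitz m1 (m2 * m3) m3 (M12_block m2 m3 t)"

definition M22 where
  "M22 m1 m2 m3 = 1\<^sub>m m1 \<otimes>\<^sub>K mat_adjoint (ones m2) \<otimes>\<^sub>K 1\<^sub>m m3"

definition M32 where
  "M32 m1 m2 m3 = mat_adjoint (M22 m1 m2 m3)"

definition M42_block :: "nat \<Rightarrow> nat \<Rightarrow> (int \<Rightarrow> int \<Rightarrow> complex mat) \<Rightarrow> int \<Rightarrow> complex mat" where
  "M42_block m2 m3 t r = block_row m2 m3 m3 (\<lambda>k. half_sum (\<lambda>s. t r (- s)) k)"

definition M42 where
  "M42 m1 m2 m3 t = toeplitz m1 m3 (m2 * m3) (M42_block m2 m3 t)"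

definition Rmat where
  "Rmat m1 m2 m3 t = minv (TBT m1 m2 m3 t)"

definition Pi1 where
  "Pi1 m1 m2 m3 t = M11 m1 m2 m3 t @\<^sub>c M31 m1 m2 m3"

definition Pi2 where
  "Pi2 m1 m2 m3 t = M12 m1 m2 m3 t @\<^sub>c M32 m1 m2 m3"

definition Pihat1 where
  "Pihat1 m1 m2 m3 t = M21 m1 m2 m3 @\<^sub>r M41 m1 m2 m3 t"

definition Pihat2 where
  "Pihat2 m1 m2 m3 t = M22 m1 m2 m3 @\<^sub>r M42 m1 m2 m3 t"

definition Gamma1 where
  "Gamma1 m1 m2 m3 t = Rmat m1 m2 m3 t * Pi1 m1 m2 m3 t"

definition Gamma2 where
  "Gamma2 m1 m2 m3 t = Rmat m1 m2 m3 t * Pi2 m1 m2 m3 t"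

definition Gammahat1 where
  "Gammahat1 m1 m2 m3 t = Pihat1 m1 m2 m3 t * Rmat m1 m2 m3 t"

definition Gammahat2 where
  "Gammahat2 m1 m2 m3 t = Pihat2 m1 m2 m3 t * Rmat m1 m2 m3 t"

section \<open>The functions of \<open>\<lambda> = (l1, l2)\<close>\<close>

definition resolvent :: "complex mat \<Rightarrow> complex \<Rightarrow> complex mat" where
  "resolvent A l = minv (A - l \<cdot>\<^sub>m 1\<^sub>m (dim_row A))"

definition res_prod :: "nat \<Rightarrow> nat \<Rightarrow> nat \<Rightarrow> complex \<Rightarrow> complex \<Rightarrow> complex mat" where
  "res_prod m1 m2 m3 l1 l2 = resolvent (A1 m1 m2 m3) l1 * resolvent (A2 m1 m2 m3) l2"

definition vhat1 where
  "vhat1 m1 m2 m3 t l1 l2 =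
     Gammahat1 m1 m2 m3 t * res_prod m1 m2 m3 l1 l2 * Lcol (m1 * m2) m3"

definition vhat2 where
  "vhat2 m1 m2 m3 t l1 l2 =
     Gammahat2 m1 m2 m3 t * res_prod m1 m2 m3 l1 l2 * Lcol (m1 * m2) m3"

text \<open>The summand added to \<open>vhat\<^sub>p\<close> uses the complementary index \<open>k \<noteq> p\<close>.\<close>

definition u_tail :: "nat \<Rightarrow> nat \<Rightarrow> complex \<Rightarrow> complex mat" where
  "u_tail mk m3 lk = \<i> \<cdot>\<^sub>m ((0\<^sub>m (mk * m3) (mk * m3) @\<^sub>r 1\<^sub>m (mk * m3))
     * ((resolvent (calA mk) lk * ones mk) \<otimes>\<^sub>K 1\<^sub>m m3))"

definition uhat1 where
  "uhat1 m1 m2 m3 t l1 l2 = vhat1 m1 m2 m3 t l1 l2 + u_tail m2 m3 l2"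

definition uhat2 where
  "uhat2 m1 m2 m3 t l1 l2 = vhat2 m1 m2 m3 t l1 l2 + u_tail m1 m3 l1"

definition uhat where
  "uhat m1 m2 m3 t l1 l2 = uhat1 m1 m2 m3 t l1 l2 @\<^sub>r uhat2 m1 m2 m3 t l1 l2"

definition K11 where
  "K11 m1 m2 m3 t = block_col m1 m3 (m2 * m3) (\<lambda>i. half_sum (M42_block m2 m3 t) i)"

definition K12 where
  "K12 m1 m2 m3 t = block_row m1 (m2 * m3) m3 (\<lambda>k. half_sum (\<lambda>j. M12_block m2 m3 t (- j)) k)"

definition Kmat where
  "Kmat m1 m2 m3 t = block_row m1 m3 (m2 * m3) (\<lambda>k. half_sum (\<lambda>j. M42_block m2 m3 t (- j)) k)"

text \<open>\<open>Gdiag m2 m3 l2\<close> is \<open>G\<^sub>1\<^sub>1\<close> and \<open>Gdiag m1 m3 l1\<close> is \<open>G\<^sub>2\<^sub>2\<close>.\<close>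

definition Gdiag :: "nat \<Rightarrow> nat \<Rightarrow> complex \<Rightarrow> complex mat" where
  "Gdiag n m3 l = (let D = (calA n - l \<cdot>\<^sub>m 1\<^sub>m n) \<otimes>\<^sub>K 1\<^sub>m m3; Z = 0\<^sub>m (n * m3) (n * m3)
     in four_block_mat D Z Z D)"

definition G21 where
  "G21 m1 m2 m3 t = \<i> \<cdot>\<^sub>m (Pihat2 m1 m2 m3 t * Gamma1 m1 m2 m3 t -
     four_block_mat (Lcol m1 m3 * mat_adjoint (Lcol m2 m3)) (0\<^sub>m (m1 * m3) (m2 * m3))
                    (K11 m1 m2 m3 t)                        (0\<^sub>m (m1 * m3) (m2 * m3)))"

definition G12 where
  "G12 m1 m2 m3 t = \<i> \<cdot>\<^sub>m (Pihat1 m1 m2 m3 t * Gamma2 m1 m2 m3 t -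
     four_block_mat (Lcol m2 m3 * mat_adjoint (Lcol m1 m3)) (0\<^sub>m (m2 * m3) (m1 * m3))
                    (K12 m1 m2 m3 t)                        (0\<^sub>m (m2 * m3) (m1 * m3)))"

definition G ::
    "nat \<Rightarrow> nat \<Rightarrow> nat \<Rightarrow> (int \<Rightarrow> int \<Rightarrow> complex mat) \<Rightarrow> complex \<Rightarrow> complex \<Rightarrow> complex mat" where
  "G m1 m2 m3 t l1 l2 = four_block_mat (Gdiag m2 m3 l2) (G12 m1 m2 m3 t)
                                       (G21 m1 m2 m3 t) (Gdiag m1 m3 l1)"

definition theta ::
    "nat \<Rightarrow> nat \<Rightarrow> nat \<Rightarrow> (int \<Rightarrow> int \<Rightarrow> complex mat) \<Rightarrow> complex \<Rightarrow> complex \<Rightarrow> complex mat" where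
  "theta m1 m2 m3 t l1 l2 = \<i> \<cdot>\<^sub>m (1\<^sub>m m3 +
     Kmat m1 m2 m3 t * Rmat m1 m2 m3 t * res_prod m1 m2 m3 l1 l2 * Lcol (m1 * m2) m3)"

end

theory Submission
  imports Defs
begin

text \<open>
  Since \<open>G\<close> is invertible, the formula for \<open>uhat\<close> is equivalent to the linear equation
  \<open>G * uhat = col[0, Lcol m2, 0, Lcol m1] * theta\<close>, and this is what \<open>G_mult_uhat\<close> proves, one
  half of the rows at a time. Write \<open>V\<close> for the product of the two resolvents applied to \<open>\<L>\<close>, and
  \<open>X\<^sub>k = (calA\<^sub>k - \<lambda>\<^sub>k)\<^sup>-\<^sup>1 \<one> \<otimes> I\<close> for the tail column in the variable \<open>\<lambda>\<^sub>k\<close>.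
  For the first half, let \<open>D\<close> be the matrix \<open>calA m2 \<otimes> I\<close> whose shift \<open>D - \<lambda>\<^sub>2\<close> fills the diagonal of
  \<open>G\<^sub>1\<^sub>1\<close>, and let \<open>N\<close> be one of the two blocks of \<open>Pihat1\<close>. Three identities meet.

  \<^item> Displacement: \<open>A2 * T - T * A2\<^sup>* = \<i> * Pi2 * Pihat2\<close>. Multiplied by \<open>R\<close> from both sides it
    turns the product \<open>R * Pi2 * Pihat2 * R\<close>, which occurs in \<open>G\<^sub>1\<^sub>2 * vhat2\<close>, into
    \<open>R * A2 - A2\<^sup>* * R\<close> up to a factor \<open>\<i>\<close>.
  \<^item> Intertwining: \<open>D * N - N * A2\<^sup>* = \<i> * (F * M22 + W)\<close>, where \<open>F\<close> is the block that \<open>G\<^sub>1\<^sub>2\<close> subtracts.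
    The remainder \<open>W\<close> is \<open>0\<close> for \<open>N = M21\<close> and \<open>Lcol m2 * K\<close> for \<open>N = M41\<close>.
  \<^item> Shift: \<open>(A2 - \<lambda>\<^sub>2) * V = M32 * X\<^sub>1\<close>, and \<open>\<i> * X\<^sub>1\<close> is the tail of \<open>uhat2\<close>.

  Together they cancel everything except \<open>\<i> * W * R * V\<close>; this is \<open>displacement_cancellation\<close>, which
  holds for arbitrary matrices that satisfy such identities. The tail \<open>\<i> * X\<^sub>2\<close> of \<open>uhat1\<close>
  contributes \<open>\<i> * Lcol m2\<close> to the second block, because \<open>D - \<lambda>\<^sub>2\<close> maps \<open>X\<^sub>2\<close> to \<open>Lcol m2\<close>, and the
  two contributions add up to \<open>Lcol m2 * theta\<close>. The other half is the same with the two directions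
  exchanged.

  The displacement identities, and the intertwining relations for \<open>M41\<close> and \<open>M42\<close>, come from
  \<open>toeplitz_identity\<close>, valid for Toeplitz matrices with rectangular blocks: multiplying by \<open>calA\<close> on the
  left and by its adjoint on the right sums the blocks over a window of indices, and the sum over the
  window splits into a contribution of the row and one of the column. It is used for \<open>T\<close>, for the
  blocks of \<open>T\<close>, and for \<open>M42\<close>. The relations for \<open>M21\<close> and \<open>M22\<close> only need that \<open>calA\<close> minus its adjoint
  has all entries equal to \<open>\<i>\<close>.
\<close>

section \<open>Entries of products and adjoints\<close>

lemma index_mult_mat_sum:
  "i < dim_row A \<Longrightarrow> j < dim_col B \<Longrightarrow> dim_col A = dim_row B \<Longrightarrow>
   (A * B) $$ (i, j) = (\<Sum>k < dim_row B. A $$ (i, k) * B $$ (k, j))"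
  by (simp add: scalar_prod_def atLeast0LessThan)

lemma sum_div_mod:
  fixes p q :: nat
  shows "(\<Sum>x < p * q. f (x div q) (x mod q)) = (\<Sum>i < p. \<Sum>j < q. f i j)"
proof -
  have "(\<Sum>i < p. \<Sum>j < q. f i j) = (\<Sum>(i, j) \<in> {..<p} \<times> {..<q}. f i j)"
    by (simp add: sum.cartesian_product)
  also have "\<dots> = (\<Sum>x < p * q. f (x div q) (x mod q))"
  proof (rule sum.reindex_bij_witness[where j = "\<lambda>(i, j). i * q + j" and i = "\<lambda>x. (x div q, x mod q)"],
      goal_cases)
    case (1 a) then show ?case by auto
  next
    case (2 a)
    obtain i j where a: "a = (i, j)" by force
    with 2 have "i < p" "j < q" by auto
    then have "Suc i * q \<le> p * q" by (intro mult_right_mono) auto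
    with a \<open>j < q\<close> show ?case by auto
  next
    case (3 b) then show ?case by auto
  next
    case (4 b)
    then have "0 < q" by (cases q) auto
    with 4 show ?case by (auto simp: less_mult_imp_div_less)
  next
    case (5 a) then show ?case by auto
  qed
  finally show ?thesis by simp
qed

lemma div_mod_less_times:
  fixes i p r :: nat
  assumes "i < p * r" shows "i div r < p" "i mod r < r"
  using assms by (auto simp: less_mult_imp_div_less) (cases r, auto)

lemma mat_adjoint_dim [simp]:
  "dim_row (mat_adjoint A) = dim_col A" "dim_col (mat_adjoint A) = dim_row A"
  by (auto simp: mat_adjoint_def)

lemma mat_adjoint_carrier [simp]:
  "A \<in> carrier_mat n m \<Longrightarrow> mat_adjoint A \<in> carrier_mat m n"
  by (auto intro!: carrier_matI)

lemma index_mat_adjoint [simp]: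
  "i < dim_col A \<Longrightarrow> j < dim_row A \<Longrightarrow> mat_adjoint A $$ (i, j) = cnj (A $$ (j, i))"
  for A :: "complex mat"
  by (simp add: mat_adjoint_def mat_of_rows_def)

section \<open>Block matrices and Kronecker products\<close>

lemma block_mat_dim [simp]:
  "dim_row (block_mat p q r c B) = p * r" "dim_col (block_mat p q r c B) = q * c"
  by (auto simp: block_mat_def)

lemma block_mat_carrier [simp]: "block_mat p q r c B \<in> carrier_mat (p * r) (q * c)"
  by (auto simp: block_mat_def)

lemma block_mat_cong:
  assumes "\<And>i k. i < p \<Longrightarrow> k < q \<Longrightarrow> B i k = C i k"
  shows "block_mat p q r c B = block_mat p q r c C"
  by (rule eq_matI) (simp_all add: block_mat_def assms less_mult_imp_div_less)

text \<open>A Kronecker product is a block matrix, so \<open>block_mat_mult\<close> below governs all products of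
  Kronecker products and block matrices; the product rules that follow are its special cases.\<close>

lemma kron_eq_block_mat:
  assumes "A \<in> carrier_mat p q" "B \<in> carrier_mat r c"
  shows "A \<otimes>\<^sub>K B = block_mat p q r c (\<lambda>i k. A $$ (i, k) \<cdot>\<^sub>m B)"
  using assms by (intro eq_matI) (auto simp: kron_def block_mat_def div_mod_less_times)

lemma block_mat_mult:
  assumes B: "\<And>i l. i < p \<Longrightarrow> l < q \<Longrightarrow> B i l \<in> carrier_mat r c"
    and C: "\<And>l k. l < q \<Longrightarrow> k < s \<Longrightarrow> C l k \<in> carrier_mat c d"
  shows "block_mat p q r c B * block_mat q s c d C =
    block_mat p s r d (\<lambda>i k. mat r d (\<lambda>ab. \<Sum>l < q. (B i l * C l k) $$ ab))"
proof (rule eq_matI, goal_cases)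
  case (1 i j)
  then have i: "i div r < p" "i mod r < r" and j: "j div d < s" "j mod d < d"
    and ij: "i < p * r" "j < s * d"
    by (auto simp: div_mod_less_times)
  let ?f = "\<lambda>l x. B (i div r) l $$ (i mod r, x) * C l (j div d) $$ (x, j mod d)"
  have "(block_mat p q r c B * block_mat q s c d C) $$ (i, j) =
      (\<Sum>x < q * c. ?f (x div c) (x mod c))"
    using ij by (subst index_mult_mat_sum) (auto simp: block_mat_def)
  also have "\<dots> = (\<Sum>l < q. \<Sum>x < c. ?f l x)" by (rule sum_div_mod)
  also have "\<dots> = (\<Sum>l < q. (B (i div r) l * C l (j div d)) $$ (i mod r, j mod d))"
  proof (rule sum.cong, simp, goal_cases)
    case (1 l)
    with i j have "B (i div r) l \<in> carrier_mat r c" "C l (j div d) \<in> carrier_mat c d"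
      using B C by auto
    with i j show ?case by (subst index_mult_mat_sum) auto
  qed
  finally show ?case using i j ij by (simp add: block_mat_def)
qed auto

lemma block_mat_add:
  assumes "\<And>i k. i < p \<Longrightarrow> k < q \<Longrightarrow> B i k \<in> carrier_mat r c"
    and "\<And>i k. i < p \<Longrightarrow> k < q \<Longrightarrow> C i k \<in> carrier_mat r c"
  shows "block_mat p q r c B + block_mat p q r c C = block_mat p q r c (\<lambda>i k. B i k + C i k)"
proof (rule eq_matI, goal_cases)
  case (1 i j)
  then show ?case
    using assms[of "i div r" "j div c"] by (auto simp: block_mat_def div_mod_less_times)
qed auto

lemma block_mat_minus:
  assumes "\<And>i k. i < p \<Longrightarrow> k < q \<Longrightarrow> B i k \<in> carrier_mat r c"
    and "\<And>i k. i < p \<Longrightarrow> k < q \<Longrightarrow> C i k \<in> carrier_mat r c"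
  shows "block_mat p q r c B - block_mat p q r c C = block_mat p q r c (\<lambda>i k. B i k - C i k)"
proof (rule eq_matI, goal_cases)
  case (1 i j)
  then show ?case
    using assms[of "i div r" "j div c"] by (auto simp: block_mat_def div_mod_less_times)
qed auto

lemma block_mat_smult:
  assumes "\<And>i k. i < p \<Longrightarrow> k < q \<Longrightarrow> B i k \<in> carrier_mat r c"
  shows "x \<cdot>\<^sub>m block_mat p q r c B = block_mat p q r c (\<lambda>i k. x \<cdot>\<^sub>m B i k)"
proof (rule eq_matI, goal_cases)
  case (1 i j)
  then show ?case
    using assms[of "i div r" "j div c"] by (auto simp: block_mat_def div_mod_less_times)
qed auto

lemma kron_dim [simp]:
  "dim_row (A \<otimes>\<^sub>K B) = dim_row A * dim_row B" "dim_col (A \<otimes>\<^sub>K B) = dim_col A * dim_col B"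
  by (auto simp: kron_def)

lemma kron_carrier [simp]:
  "A \<in> carrier_mat p q \<Longrightarrow> B \<in> carrier_mat r c \<Longrightarrow> A \<otimes>\<^sub>K B \<in> carrier_mat (p * r) (q * c)"
  by (auto simp: kron_def)

lemma kron_one_mult_block_mat:
  assumes X: "X \<in> carrier_mat s p"
    and B: "\<And>i k. i < p \<Longrightarrow> k < q \<Longrightarrow> B i k \<in> carrier_mat r c"
  shows "(X \<otimes>\<^sub>K 1\<^sub>m r) * block_mat p q r c B =
    block_mat s q r c (\<lambda>i k. mat r c (\<lambda>ab. \<Sum>l < p. X $$ (i, l) * B l k $$ ab))"
proof -
  have "(X \<otimes>\<^sub>K 1\<^sub>m r) * block_mat p q r c B = block_mat s q r c
      (\<lambda>i k. mat r c (\<lambda>ab. \<Sum>l < p. ((X $$ (i, l) \<cdot>\<^sub>m 1\<^sub>m r) * B l k) $$ ab))"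
    using X B by (subst kron_eq_block_mat[OF X one_carrier_mat], subst block_mat_mult) auto
  also have "\<dots> = block_mat s q r c (\<lambda>i k. mat r c (\<lambda>ab. \<Sum>l < p. X $$ (i, l) * B l k $$ ab))"
  proof (intro block_mat_cong eq_matI, goal_cases)
    case (1 i k a b)
    have "((X $$ (i, l) \<cdot>\<^sub>m 1\<^sub>m r) * B l k) $$ (a, b) = X $$ (i, l) * B l k $$ (a, b)" if "l < p" for l
      using B[OF that 1(2)] 1 by (subst mult_smult_assoc_mat[of _ r r _ c]) auto
    with 1 show ?case by auto
  qed auto
  finally show ?thesis .
qed

lemma block_mat_mult_kron_one:
  assumes Y: "Y \<in> carrier_mat q s"
    and B: "\<And>i k. i < p \<Longrightarrow> k < q \<Longrightarrow> B i k \<in> carrier_mat r c"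
  shows "block_mat p q r c B * (Y \<otimes>\<^sub>K 1\<^sub>m c) =
    block_mat p s r c (\<lambda>i k. mat r c (\<lambda>ab. \<Sum>l < q. B i l $$ ab * Y $$ (l, k)))"
proof -
  have "block_mat p q r c B * (Y \<otimes>\<^sub>K 1\<^sub>m c) = block_mat p s r c
      (\<lambda>i k. mat r c (\<lambda>ab. \<Sum>l < q. (B i l * (Y $$ (l, k) \<cdot>\<^sub>m 1\<^sub>m c)) $$ ab))"
    using Y B by (subst kron_eq_block_mat[OF Y one_carrier_mat], subst block_mat_mult) auto
  also have "\<dots> = block_mat p s r c (\<lambda>i k. mat r c (\<lambda>ab. \<Sum>l < q. B i l $$ ab * Y $$ (l, k)))"
  proof (intro block_mat_cong eq_matI, goal_cases)
    case (1 i k a b)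
    have "(B i l * (Y $$ (l, k) \<cdot>\<^sub>m 1\<^sub>m c)) $$ (a, b) = B i l $$ (a, b) * Y $$ (l, k)" if "l < q" for l
      using B[OF 1(1) that] 1 by (subst mult_smult_distrib[of _ r c _ c]) auto
    with 1 show ?case by auto
  qed auto
  finally show ?thesis .
qed

lemma index_smult_mult_mat:
  "A \<in> carrier_mat r c \<Longrightarrow> B \<in> carrier_mat c d \<Longrightarrow> i < r \<Longrightarrow> j < d \<Longrightarrow>
   (x \<cdot>\<^sub>m (A * B)) $$ (i, j) = x * (A * B) $$ (i, j)"
  for x :: complex
  by (rule index_smult_mat) auto

lemma one_kron_mult_block_mat:
  assumes X: "X \<in> carrier_mat s r"
    and B: "\<And>i k. i < p \<Longrightarrow> k < q \<Longrightarrow> B i k \<in> carrier_mat r c"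
  shows "(1\<^sub>m p \<otimes>\<^sub>K X) * block_mat p q r c B = block_mat p q s c (\<lambda>i k. X * B i k)"
proof -
  have "(1\<^sub>m p \<otimes>\<^sub>K X) * block_mat p q r c B = block_mat p q s c
      (\<lambda>i k. mat s c (\<lambda>ab. \<Sum>l < p. ((1\<^sub>m p $$ (i, l) \<cdot>\<^sub>m X) * B l k) $$ ab))"
    using X B by (subst kron_eq_block_mat[OF one_carrier_mat X], subst block_mat_mult) auto
  also have "\<dots> = block_mat p q s c (\<lambda>i k. X * B i k)"
  proof (intro block_mat_cong eq_matI, goal_cases)
    case (1 i k a b)
    have Bi: "B i k \<in> carrier_mat r c" using B 1 by auto
    have "((1\<^sub>m p $$ (i, l) \<cdot>\<^sub>m X) * B l k) $$ (a, b) = (if l = i then (X * B i k) $$ (a, b) else 0)"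
      if "l < p" for l
      using B[OF that 1(2)] 1 X Bi that
      by (subst mult_smult_assoc_mat[of _ s r _ c])
         (auto simp: index_smult_mult_mat simp del: index_mult_mat(1))
    then have "(\<Sum>l < p. ((1\<^sub>m p $$ (i, l) \<cdot>\<^sub>m X) * B l k) $$ (a, b)) =
        (\<Sum>l < p. if l = i then (X * B i k) $$ (a, b) else 0)"
      by (intro sum.cong) auto
    with 1 X Bi show ?case by (simp del: index_mult_mat(1))
  qed (use X B in auto)
  finally show ?thesis .
qed

lemma block_mat_mult_one_kron:
  assumes X: "X \<in> carrier_mat c s"
    and B: "\<And>i k. i < p \<Longrightarrow> k < q \<Longrightarrow> B i k \<in> carrier_mat r c"
  shows "block_mat p q r c B * (1\<^sub>m q \<otimes>\<^sub>K X) = block_mat p q r s (\<lambda>i k. B i k * X)"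
proof -
  have "block_mat p q r c B * (1\<^sub>m q \<otimes>\<^sub>K X) = block_mat p q r s
      (\<lambda>i k. mat r s (\<lambda>ab. \<Sum>l < q. (B i l * (1\<^sub>m q $$ (l, k) \<cdot>\<^sub>m X)) $$ ab))"
    using X B by (subst kron_eq_block_mat[OF one_carrier_mat X], subst block_mat_mult) auto
  also have "\<dots> = block_mat p q r s (\<lambda>i k. B i k * X)"
  proof (intro block_mat_cong eq_matI, goal_cases)
    case (1 i k a b)
    have Bi: "B i k \<in> carrier_mat r c" using B 1 by auto
    have "(B i l * (1\<^sub>m q $$ (l, k) \<cdot>\<^sub>m X)) $$ (a, b) = (if l = k then (B i k * X) $$ (a, b) else 0)"
      if "l < q" for l
      using B[OF 1(1) that] 1 X Bi that
      by (subst mult_smult_distrib[of _ r c _ s])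
         (auto simp: index_smult_mult_mat simp del: index_mult_mat(1))
    then have "(\<Sum>l < q. (B i l * (1\<^sub>m q $$ (l, k) \<cdot>\<^sub>m X)) $$ (a, b)) =
        (\<Sum>l < q. if l = k then (B i k * X) $$ (a, b) else 0)"
      by (intro sum.cong) auto
    with 1 X Bi show ?case by (simp del: index_mult_mat(1))
  qed (use X B in auto)
  finally show ?thesis .
qed

lemma kron_mult_kron:
  assumes A: "A \<in> carrier_mat p q" and B: "B \<in> carrier_mat r c"
    and C: "C \<in> carrier_mat q s" and D: "D \<in> carrier_mat c d"
  shows "(A \<otimes>\<^sub>K B) * (C \<otimes>\<^sub>K D) = (A * C) \<otimes>\<^sub>K (B * D)"
proof -
  have "(A \<otimes>\<^sub>K B) * (C \<otimes>\<^sub>K D) = block_mat p s r d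
      (\<lambda>i k. mat r d (\<lambda>ab. \<Sum>l < q. ((A $$ (i, l) \<cdot>\<^sub>m B) * (C $$ (l, k) \<cdot>\<^sub>m D)) $$ ab))"
    unfolding kron_eq_block_mat[OF A B] kron_eq_block_mat[OF C D]
    using B D by (intro block_mat_mult) auto
  also have "\<dots> = block_mat p s r d (\<lambda>i k. (A * C) $$ (i, k) \<cdot>\<^sub>m (B * D))"
  proof (intro block_mat_cong eq_matI, goal_cases)
    case (1 i k a b)
    have "((x \<cdot>\<^sub>m B) * (y \<cdot>\<^sub>m D)) $$ (a, b) = x * y * (B * D) $$ (a, b)" for x y
      using 1 B D
      by (subst mult_smult_assoc_mat[of _ r c _ d], simp, simp,
          subst mult_smult_distrib[of _ r c _ d]) (auto simp del: index_mult_mat(1))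
    moreover have "(A * C) $$ (i, k) = (\<Sum>l < q. A $$ (i, l) * C $$ (l, k))"
      using 1 A C by (subst index_mult_mat_sum) auto
    ultimately show ?case
      using 1 B D by (simp add: sum_distrib_right del: index_mult_mat(1))
  qed (use B D in auto)
  also have "\<dots> = (A * C) \<otimes>\<^sub>K (B * D)"
    using A B C D by (intro kron_eq_block_mat[symmetric]) auto
  finally show ?thesis .
qed

lemma kron_assoc: "(A \<otimes>\<^sub>K B) \<otimes>\<^sub>K C = A \<otimes>\<^sub>K (B \<otimes>\<^sub>K C)"
proof (rule eq_matI, goal_cases)
  case (1 i j)
  have *: "i mod (b * c) div c = i div c mod b" for i b c :: nat
    by (cases "c = 0"; cases "b = 0") (auto simp: mod_mult2_eq mult.commute[of b c])
  have **: "i mod (b * c) mod c = i mod c" for i b c :: nat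
    by (simp add: mod_mod_cancel)
  show ?case using 1
    by (auto simp: kron_def div_mod_less_times mult.assoc[symmetric] div_mult2_eq[symmetric] * **)
       (auto simp: div_mod_less_times mult.assoc div_mult2_eq[symmetric] * ** mult.commute)
qed (auto simp: mult.assoc)

lemma mat_adjoint_kron: "mat_adjoint (A \<otimes>\<^sub>K B) = mat_adjoint A \<otimes>\<^sub>K mat_adjoint B"
  by (rule eq_matI) (auto simp: kron_def div_mod_less_times)

lemma mat_adjoint_one [simp]: "mat_adjoint (1\<^sub>m n :: complex mat) = 1\<^sub>m n"
  by (rule eq_matI) auto

lemma mat_adjoint_adjoint [simp]: "mat_adjoint (mat_adjoint A) = A" for A :: "complex mat"
  by (rule eq_matI) auto

lemma one_kron_one: "1\<^sub>m p \<otimes>\<^sub>K 1\<^sub>m q = 1\<^sub>m (p * q)"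
proof (rule eq_matI, goal_cases)
  case (1 i j)
  have "i = j \<longleftrightarrow> i div q = j div q \<and> i mod q = j mod q" by (metis div_mult_mod_eq)
  with 1 show ?case by (auto simp: kron_def div_mod_less_times)
qed auto

lemma one1_kron: "1\<^sub>m (Suc 0) \<otimes>\<^sub>K A = A"
  by (rule eq_matI) (auto simp: kron_def)

lemma ones_mult: "ones (p * q) = ones p \<otimes>\<^sub>K ones q"
  by (rule eq_matI) (auto simp: kron_def ones_def div_mod_less_times)

lemma ones_carrier [simp]: "ones n \<in> carrier_mat n 1" "ones n \<in> carrier_mat n (Suc 0)"
  by (simp_all add: ones_def)

lemma kron_minus_left:
  "A \<in> carrier_mat p q \<Longrightarrow> B \<in> carrier_mat p q \<Longrightarrow> (A - B) \<otimes>\<^sub>K C = A \<otimes>\<^sub>K C - B \<otimes>\<^sub>K C"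
  by (rule eq_matI) (auto simp: kron_def div_mod_less_times algebra_simps)

lemma kron_minus_right:
  "A \<in> carrier_mat p q \<Longrightarrow> B \<in> carrier_mat p q \<Longrightarrow> C \<otimes>\<^sub>K (A - B) = C \<otimes>\<^sub>K A - C \<otimes>\<^sub>K B"
  by (rule eq_matI) (auto simp: kron_def div_mod_less_times algebra_simps)

lemma kron_smult_left: "(x \<cdot>\<^sub>m A) \<otimes>\<^sub>K C = x \<cdot>\<^sub>m (A \<otimes>\<^sub>K C)"
  by (rule eq_matI) (auto simp: kron_def div_mod_less_times algebra_simps)

lemma kron_smult_right: "C \<otimes>\<^sub>K (x \<cdot>\<^sub>m A) = x \<cdot>\<^sub>m (C \<otimes>\<^sub>K A)"
  by (rule eq_matI) (auto simp: kron_def div_mod_less_times)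

section \<open>Half sums\<close>

text \<open>Half sums are linear in the family of blocks. This carries an identity that holds for each block
  over to \<open>M41\<close>, \<open>K12\<close> and \<open>Kmat\<close>, whose blocks are half sums.\<close>

lemma half_sum_carrier [simp]: "F 0 \<in> carrier_mat r c \<Longrightarrow> half_sum F i \<in> carrier_mat r c"
  by (auto simp: half_sum_def)

lemma half_sum_dim [simp]:
  "dim_row (half_sum F i) = dim_row (F 0)" "dim_col (half_sum F i) = dim_col (F 0)"
  by (auto simp: half_sum_def)

lemma index_half_sum:
  "F 0 \<in> carrier_mat r c \<Longrightarrow> a < r \<Longrightarrow> b < c \<Longrightarrow>
   half_sum F i $$ (a, b) = F 0 $$ (a, b) / 2 + (\<Sum>s = 1..i. F (int s) $$ (a, b))"
  by (auto simp: half_sum_def)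

lemma half_sum_cong:
  assumes "\<And>s. s \<le> i \<Longrightarrow> F (int s) = F' (int s)"
  shows "half_sum F i = half_sum F' i"
  using assms[of 0] assms by (auto simp: half_sum_def intro!: eq_matI sum.cong)

lemma half_sum_mult_left:
  assumes X: "X \<in> carrier_mat q r" and F: "\<And>s. s \<le> i \<Longrightarrow> F (int s) \<in> carrier_mat r c"
  shows "half_sum (\<lambda>s. X * F s) i = X * half_sum F i"
proof (rule eq_matI, goal_cases)
  case (1 a b)
  have F0: "F 0 \<in> carrier_mat r c" using F[of 0] by simp
  have XF: "(X * F (int s)) $$ (a, b) = (\<Sum>x < r. X $$ (a, x) * F (int s) $$ (x, b))" if "s \<le> i" for s
    using 1 X F[OF that] F0 by (subst index_mult_mat_sum) auto
  have "half_sum (\<lambda>s. X * F s) i $$ (a, b) =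
      (\<Sum>x < r. X $$ (a, x) * F 0 $$ (x, b)) / 2 +
      (\<Sum>s = 1..i. \<Sum>x < r. X $$ (a, x) * F (int s) $$ (x, b))"
    using 1 X F0 XF[of 0] XF by (subst index_half_sum[of _ q c]) auto
  also have "\<dots> = (\<Sum>x < r. X $$ (a, x) * half_sum F i $$ (x, b))"
    using 1 F0
    by (subst sum.swap) (auto simp: index_half_sum sum_distrib_left sum.distrib ring_distribs sum_divide_distrib)
  also have "\<dots> = (X * half_sum F i) $$ (a, b)"
    using 1 X F0 by (subst index_mult_mat_sum) auto
  finally show ?case .
qed (use X in auto)

lemma half_sum_mult_right:
  assumes X: "X \<in> carrier_mat c q" and F: "\<And>s. s \<le> i \<Longrightarrow> F (int s) \<in> carrier_mat r c"
  shows "half_sum (\<lambda>s. F s * X) i = half_sum F i * X"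
proof (rule eq_matI, goal_cases)
  case (1 a b)
  have F0: "F 0 \<in> carrier_mat r c" using F[of 0] by simp
  have XF: "(F (int s) * X) $$ (a, b) = (\<Sum>x < c. F (int s) $$ (a, x) * X $$ (x, b))" if "s \<le> i" for s
    using 1 X F[OF that] F0 by (subst index_mult_mat_sum) auto
  have "half_sum (\<lambda>s. F s * X) i $$ (a, b) =
      (\<Sum>x < c. F 0 $$ (a, x) * X $$ (x, b)) / 2 +
      (\<Sum>s = 1..i. \<Sum>x < c. F (int s) $$ (a, x) * X $$ (x, b))"
    using 1 X F0 XF[of 0] XF by (subst index_half_sum[of _ r q]) auto
  also have "\<dots> = (\<Sum>x < c. half_sum F i $$ (a, x) * X $$ (x, b))"
    using 1 F0
    by (subst sum.swap) (auto simp: index_half_sum sum_distrib_right sum.distrib ring_distribs sum_divide_distrib)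
  also have "\<dots> = (half_sum F i * X) $$ (a, b)"
    using 1 X F0 by (subst index_mult_mat_sum) auto
  finally show ?case .
qed (use X in auto)

lemma half_sum_add:
  assumes F: "\<And>s. s \<le> i \<Longrightarrow> F (int s) \<in> carrier_mat r c"
    and H: "\<And>s. s \<le> i \<Longrightarrow> H (int s) \<in> carrier_mat r c"
  shows "half_sum (\<lambda>s. F s + H s) i = half_sum F i + half_sum H i"
proof (rule eq_matI, goal_cases)
  case (1 a b)
  have 0: "F 0 \<in> carrier_mat r c" "H 0 \<in> carrier_mat r c" using F[of 0] H[of 0] by auto
  with 1 have ab: "a < r" "b < c" by auto
  have "(F (int s) + H (int s)) $$ (a, b) = F (int s) $$ (a, b) + H (int s) $$ (a, b)" if "s \<le> i" for s
    using F[OF that] H[OF that] ab by auto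
  with 0 ab show ?case
    by (auto simp: index_half_sum[of _ r c] sum.distrib add_divide_distrib)
qed (use F[of 0] H[of 0] in auto)

lemma half_sum_smult:
  assumes F: "\<And>s. s \<le> i \<Longrightarrow> F (int s) \<in> carrier_mat r c"
  shows "half_sum (\<lambda>s. x \<cdot>\<^sub>m F s) i = x \<cdot>\<^sub>m half_sum F i"
proof (rule eq_matI, goal_cases)
  case (1 a b)
  have 0: "F 0 \<in> carrier_mat r c" using F[of 0] by auto
  with 1 have ab: "a < r" "b < c" by auto
  have "(x \<cdot>\<^sub>m F (int s)) $$ (a, b) = x * F (int s) $$ (a, b)" if "s \<le> i" for s
    using F[OF that] ab by auto
  with 0 ab show ?case
    by (auto simp: index_half_sum[of _ r c] sum_distrib_left ring_distribs)
qed (use F[of 0] in auto)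

lemma half_sum_minus:
  assumes F: "\<And>s. s \<le> i \<Longrightarrow> F (int s) \<in> carrier_mat r c"
    and H: "\<And>s. s \<le> i \<Longrightarrow> H (int s) \<in> carrier_mat r c"
  shows "half_sum (\<lambda>s. F s - H s) i = half_sum F i - half_sum H i"
proof (rule eq_matI, goal_cases)
  case (1 a b)
  have 0: "F 0 \<in> carrier_mat r c" "H 0 \<in> carrier_mat r c" using F[of 0] H[of 0] by auto
  with 1 have ab: "a < r" "b < c" by auto
  have "(F (int s) - H (int s)) $$ (a, b) = F (int s) $$ (a, b) - H (int s) $$ (a, b)" if "s \<le> i" for s
    using F[OF that] H[OF that] ab by auto
  with 0 ab show ?case
    by (auto simp: index_half_sum[of _ r c] minus_carrier_mat sum_subtractf diff_divide_distrib)
qed (use F[of 0] H[of 0] in auto)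

section \<open>The displacement of a block Toeplitz matrix\<close>

lemma calA_carrier [simp]: "calA n \<in> carrier_mat n n"
  by (simp add: calA_def)

text \<open>Below the diagonal the entries come from \<open>calA\<close>, above it from the adjoint, and on it from both with
  half the weight: every entry is \<open>\<i>\<close>.\<close>

lemma calA_minus_adjoint:
  "calA n - mat_adjoint (calA n) = \<i> \<cdot>\<^sub>m (ones n * mat_adjoint (ones n))"
proof (rule eq_matI, goal_cases)
  case (1 i j)
  then show ?case by (subst index_smult_mat) (auto simp: calA_def ones_def index_mult_mat_sum simp del: index_mult_mat(1))
qed (auto simp: calA_def ones_def)

text \<open>The terms on the left are the values of \<open>f\<close> on the window from \<open>- k\<close> to \<open>i\<close>, cut at \<open>i - k\<close>; on the
  right the same window is cut at \<open>0\<close>.\<close>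

lemma sum_toeplitz_window:
  fixes f :: "int \<Rightarrow> 'a :: comm_ring_1"
  shows "f (int i - int k) + (\<Sum>l < i. f (int l - int k)) + (\<Sum>l < k. f (int i - int l)) =
    f 0 + (\<Sum>s = 1..i. f (int s)) + (\<Sum>s = 1..k. f (- int s))"
proof (induction i)
  case 0
  show ?case by (induction k) (auto simp: algebra_simps)
next
  case (Suc i)
  have "(\<Sum>l < k. f (int (Suc i) - int l)) = (\<Sum>l < k. f (int i - int l)) + f (int (Suc i)) - f (int (Suc i) - int k)"
    by (induction k) (auto simp: algebra_simps)
  then have "f (int (Suc i) - int k) + (\<Sum>l < Suc i. f (int l - int k)) + (\<Sum>l < k. f (int (Suc i) - int l)) =
      (f (int i - int k) + (\<Sum>l < i. f (int l - int k)) + (\<Sum>l < k. f (int i - int l))) + f (int (Suc i))"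
    by (simp only: sum.lessThan_Suc) (simp add: algebra_simps)
  with Suc show ?case by (simp add: algebra_simps)
qed

text \<open>The weights \<open>1 / 2\<close> on the diagonal of \<open>calA\<close> and of its adjoint together give the value at the cut
  point \<open>i - k\<close> weight one, and likewise the two half sums share the value at \<open>0\<close>.\<close>

lemma calA_toeplitz_entry:
  fixes f :: "int \<Rightarrow> complex"
  assumes "i < n" "k < n"
  shows "(\<Sum>l < n. calA n $$ (i, l) * f (int l - int k)) -
     (\<Sum>l < n. f (int i - int l) * mat_adjoint (calA n) $$ (l, k)) =
    \<i> * ((f 0 / 2 + (\<Sum>s = 1..i. f (int s))) + (f 0 / 2 + (\<Sum>s = 1..k. f (- int s))))"
proof -
  have split: "(\<Sum>l < n. g l) = g j + (\<Sum>l < j. g l)"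
    if "\<And>l. j < l \<Longrightarrow> l < n \<Longrightarrow> g l = 0" "j < n" for g :: "nat \<Rightarrow> complex" and j
  proof -
    have "(\<Sum>l < n. g l) = (\<Sum>l < Suc j. g l)"
      using that by (intro sum.mono_neutral_right) auto
    then show ?thesis by simp
  qed
  have "(\<Sum>l < n. calA n $$ (i, l) * f (int l - int k)) =
      \<i> * (f (int i - int k) / 2 + (\<Sum>l < i. f (int l - int k)))"
    using assms by (subst split[of i]) (auto simp: calA_def ring_distribs sum_distrib_left)
  moreover have "(\<Sum>l < n. f (int i - int l) * mat_adjoint (calA n) $$ (l, k)) =
      - \<i> * (f (int i - int k) / 2 + (\<Sum>l < k. f (int i - int l)))"
    using assms
    by (subst split[of k]) (auto simp: calA_def ring_distribs sum_distrib_left sum_negf mult.commute[of _ \<i>])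
  ultimately show ?thesis
    using sum_toeplitz_window[of f i k] by (simp add: algebra_simps flip: distrib_left)
qed

lemma toeplitz_carrier [simp]: "toeplitz n r c B \<in> carrier_mat (n * r) (n * c)"
  by (simp add: toeplitz_def)

text \<open>The entrywise identity in matrix form: a term that depends on the row index and not on the column
  index is a block column times a row of ones, so the right-hand side has small rank. Wide
  blocks are admitted because \<open>M42\<close> has them.\<close>

lemma toeplitz_identity:
  assumes B: "\<And>s. \<bar>s\<bar> < int n \<Longrightarrow> B s \<in> carrier_mat r c"
  shows "(calA n \<otimes>\<^sub>K 1\<^sub>m r) * toeplitz n r c B - toeplitz n r c B * (mat_adjoint (calA n) \<otimes>\<^sub>K 1\<^sub>m c) =
    \<i> \<cdot>\<^sub>m (block_col n r c (half_sum B) * (mat_adjoint (ones n) \<otimes>\<^sub>K 1\<^sub>m c) +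
      (ones n \<otimes>\<^sub>K 1\<^sub>m r) * block_row n r c (half_sum (\<lambda>s. B (- s))))"
proof (cases "n = 0")
  case True
  then show ?thesis by (intro eq_matI) (auto simp: toeplitz_def ones_def calA_def)
next
  case False
  then have B0: "B 0 \<in> carrier_mat r c" using B by auto
  have hs: "half_sum B i \<in> carrier_mat r c" "half_sum (\<lambda>s. B (- s)) i \<in> carrier_mat r c" for i
    using B0 by auto
  have "(calA n \<otimes>\<^sub>K 1\<^sub>m r) * toeplitz n r c B - toeplitz n r c B * (mat_adjoint (calA n) \<otimes>\<^sub>K 1\<^sub>m c) =
    block_mat n n r c (\<lambda>i k.
      mat r c (\<lambda>ab. \<Sum>l < n. calA n $$ (i, l) * B (int l - int k) $$ ab) -
      mat r c (\<lambda>ab. \<Sum>l < n. B (int i - int l) $$ ab * mat_adjoint (calA n) $$ (l, k)))"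
    unfolding toeplitz_def using B
    by (subst kron_one_mult_block_mat[of _ n], simp, simp, subst block_mat_mult_kron_one[of _ _ n], simp,
        simp, subst block_mat_minus) auto
  also have "\<dots> = block_mat n n r c (\<lambda>i k. \<i> \<cdot>\<^sub>m (
      mat r c (\<lambda>ab. \<Sum>l < 1. half_sum B i $$ ab * mat_adjoint (ones n) $$ (l, k)) +
      mat r c (\<lambda>ab. \<Sum>l < 1. ones n $$ (i, l) * half_sum (\<lambda>s. B (- s)) k $$ ab)))"
  proof (intro block_mat_cong eq_matI, goal_cases)
    case (1 i k a b)
    with calA_toeplitz_entry[of i n k "\<lambda>s. B s $$ (a, b)"] B0 show ?case
      by (auto simp: ones_def index_half_sum[of _ r c])
  qed auto
  also have "\<dots> = \<i> \<cdot>\<^sub>m (block_col n r c (half_sum B) * (mat_adjoint (ones n) \<otimes>\<^sub>K 1\<^sub>m c) +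
      (ones n \<otimes>\<^sub>K 1\<^sub>m r) * block_row n r c (half_sum (\<lambda>s. B (- s))))"
    using hs
    by (subst kron_one_mult_block_mat[of _ n], simp, simp, subst block_mat_mult_kron_one[of _ _ n],
        simp,
        simp, subst block_mat_add, simp, simp, subst block_mat_smult) auto
  finally show ?thesis .
qed

section \<open>Inverses and resolvents\<close>

text \<open>A one-sided inverse is enough, since determinants are multiplicative.\<close>

lemma minv_eqI:
  assumes A: "A \<in> carrier_mat n n" and B: "B \<in> carrier_mat n n" and AB: "A * B = 1\<^sub>m n"
  shows "minv A = B"
proof -
  have "det A * det B = 1" using det_mult[OF A B] AB by simp
  then have "det A \<noteq> 0" by auto
  note inv = minv[OF A this]
  have "minv A = minv A * (A * B)" using inv AB right_mult_one_mat[of "minv A" n n] by simp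
  also have "\<dots> = (minv A * A) * B" using inv A B by (intro assoc_mult_mat[symmetric]) auto
  finally show ?thesis using inv B by simp
qed

lemma det_calA_minus:
  assumes "l \<noteq> \<i> / 2"
  shows "det (calA n - l \<cdot>\<^sub>m 1\<^sub>m n) \<noteq> 0"
  using assms
  by (subst det_lower_triangular[of n]) (auto simp: calA_def diag_mat_def prod_list_zero_iff minus_carrier_mat)

lemma resolvent_props:
  assumes A: "A \<in> carrier_mat n n" and det: "det (A - l \<cdot>\<^sub>m 1\<^sub>m n) \<noteq> 0"
  shows "resolvent A l \<in> carrier_mat n n" "(A - l \<cdot>\<^sub>m 1\<^sub>m n) * resolvent A l = 1\<^sub>m n"
  using minv[of "A - l \<cdot>\<^sub>m 1\<^sub>m n" n] A det by (auto simp: resolvent_def minus_carrier_mat)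

lemma shift_kron_one:
  assumes "A \<in> carrier_mat n n"
  shows "(A \<otimes>\<^sub>K 1\<^sub>m r) - l \<cdot>\<^sub>m 1\<^sub>m (n * r) = (A - l \<cdot>\<^sub>m 1\<^sub>m n) \<otimes>\<^sub>K 1\<^sub>m r"
  using assms by (simp add: kron_minus_left[of _ n n] kron_smult_left one_kron_one)

lemma shift_one_kron:
  assumes "A \<in> carrier_mat n n"
  shows "(1\<^sub>m r \<otimes>\<^sub>K A) - l \<cdot>\<^sub>m 1\<^sub>m (r * n) = 1\<^sub>m r \<otimes>\<^sub>K (A - l \<cdot>\<^sub>m 1\<^sub>m n)"
  using assms by (simp add: kron_minus_right[of _ n n] kron_smult_right one_kron_one)

lemma resolvent_kron_one:
  assumes A: "A \<in> carrier_mat n n" and det: "det (A - l \<cdot>\<^sub>m 1\<^sub>m n) \<noteq> 0"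
  shows "resolvent (A \<otimes>\<^sub>K 1\<^sub>m r) l = resolvent A l \<otimes>\<^sub>K 1\<^sub>m r"
  unfolding resolvent_def[of "A \<otimes>\<^sub>K 1\<^sub>m r"]
proof (rule minv_eqI)
  note R = resolvent_props[OF A det]
  have d: "A - l \<cdot>\<^sub>m 1\<^sub>m n \<in> carrier_mat n n" using A by (simp add: minus_carrier_mat)
  show "A \<otimes>\<^sub>K 1\<^sub>m r - l \<cdot>\<^sub>m 1\<^sub>m (dim_row (A \<otimes>\<^sub>K 1\<^sub>m r)) \<in> carrier_mat (n * r) (n * r)"
    using A by (simp add: minus_carrier_mat)
  show "resolvent A l \<otimes>\<^sub>K 1\<^sub>m r \<in> carrier_mat (n * r) (n * r)"
    using R by simp
  show "(A \<otimes>\<^sub>K 1\<^sub>m r - l \<cdot>\<^sub>m 1\<^sub>m (dim_row (A \<otimes>\<^sub>K 1\<^sub>m r))) * (resolvent A l \<otimes>\<^sub>K 1\<^sub>m r) = 1\<^sub>m (n * r)"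
    using A R kron_mult_kron[OF d one_carrier_mat R(1) one_carrier_mat]
    by (simp add: shift_kron_one one_kron_one)
qed

lemma resolvent_one_kron:
  assumes A: "A \<in> carrier_mat n n" and det: "det (A - l \<cdot>\<^sub>m 1\<^sub>m n) \<noteq> 0"
  shows "resolvent (1\<^sub>m r \<otimes>\<^sub>K A) l = 1\<^sub>m r \<otimes>\<^sub>K resolvent A l"
  unfolding resolvent_def[of "1\<^sub>m r \<otimes>\<^sub>K A"]
proof (rule minv_eqI)
  note R = resolvent_props[OF A det]
  have d: "A - l \<cdot>\<^sub>m 1\<^sub>m n \<in> carrier_mat n n" using A by (simp add: minus_carrier_mat)
  show "1\<^sub>m r \<otimes>\<^sub>K A - l \<cdot>\<^sub>m 1\<^sub>m (dim_row (1\<^sub>m r \<otimes>\<^sub>K A)) \<in> carrier_mat (r * n) (r * n)"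
    using A by (simp add: minus_carrier_mat)
  show "1\<^sub>m r \<otimes>\<^sub>K resolvent A l \<in> carrier_mat (r * n) (r * n)"
    using R by simp
  show "(1\<^sub>m r \<otimes>\<^sub>K A - l \<cdot>\<^sub>m 1\<^sub>m (dim_row (1\<^sub>m r \<otimes>\<^sub>K A))) * (1\<^sub>m r \<otimes>\<^sub>K resolvent A l) = 1\<^sub>m (r * n)"
    using A R kron_mult_kron[OF one_carrier_mat d one_carrier_mat R(1)]
    by (simp add: shift_one_kron one_kron_one)
qed

definition resolved_ones :: "nat \<Rightarrow> complex \<Rightarrow> complex mat" where
  "resolved_ones n l = resolvent (calA n) l * ones n"

lemma resolved_ones:
  assumes "l \<noteq> \<i> / 2"
  shows "resolved_ones n l \<in> carrier_mat n 1"
    and "(calA n - l \<cdot>\<^sub>m 1\<^sub>m n) * resolved_ones n l = ones n"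
proof -
  note R = resolvent_props[OF calA_carrier det_calA_minus[OF assms], of n]
  show "resolved_ones n l \<in> carrier_mat n 1"
    unfolding resolved_ones_def using R by (intro mult_carrier_mat[of _ _ n]) auto
  have "(calA n - l \<cdot>\<^sub>m 1\<^sub>m n) * resolved_ones n l = ((calA n - l \<cdot>\<^sub>m 1\<^sub>m n) * resolvent (calA n) l) * ones n"
    unfolding resolved_ones_def using R
    by (intro assoc_mult_mat[symmetric, of _ n n _ n _ 1]) (auto simp: minus_carrier_mat)
  then show "(calA n - l \<cdot>\<^sub>m 1\<^sub>m n) * resolved_ones n l = ones n"
    using R by (simp add: left_mult_one_mat[of _ n 1])
qed

section \<open>Stacked matrices\<close>

lemma append_cols_carrier [simp]:
  "A \<in> carrier_mat n a \<Longrightarrow> B \<in> carrier_mat n b \<Longrightarrow> A @\<^sub>c B \<in> carrier_mat n (a + b)"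
  by (auto simp: append_cols_def)

lemma append_rows_mult:
  fixes A :: "complex mat"
  assumes "A \<in> carrier_mat a n" "B \<in> carrier_mat b n" "C \<in> carrier_mat n c"
  shows "(A @\<^sub>r B) * C = (A * C) @\<^sub>r (B * C)"
proof -
  have "C = four_block_mat C (0\<^sub>m n 0) (0\<^sub>m 0 c) (0\<^sub>m 0 0)"
    using assms by (intro eq_matI) auto
  then have "(A @\<^sub>r B) * C = four_block_mat A (0\<^sub>m a 0) B (0\<^sub>m b 0) * four_block_mat C (0\<^sub>m n 0) (0\<^sub>m 0 c) (0\<^sub>m 0 0)"
    using assms by (simp add: append_rows_def)
  also have "\<dots> = (A * C) @\<^sub>r (B * C)"
    using assms by (subst mult_four_block_mat[of _ a n _ 0 _ b _ _ c _ 0]) (auto simp: append_rows_def)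
  finally show ?thesis .
qed

lemma mult_append_cols:
  assumes "A \<in> carrier_mat a n" "B \<in> carrier_mat n b" "C \<in> carrier_mat n c"
  shows "A * (B @\<^sub>c C) = (A * B) @\<^sub>c (A * C)"
proof -
  have "A = four_block_mat A (0\<^sub>m a 0) (0\<^sub>m 0 n) (0\<^sub>m 0 0)"
    using assms by (intro eq_matI) auto
  then have "A * (B @\<^sub>c C) = four_block_mat A (0\<^sub>m a 0) (0\<^sub>m 0 n) (0\<^sub>m 0 0) * four_block_mat B C (0\<^sub>m 0 b) (0\<^sub>m 0 c)"
    using assms by (simp add: append_cols_def)
  also have "\<dots> = (A * B) @\<^sub>c (A * C)"
    using assms by (subst mult_four_block_mat[of _ a n _ 0 _ 0 _ _ b _ c]) (auto simp: append_cols_def)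
  finally show ?thesis .
qed

lemma append_rows_mult_append_cols:
  assumes "A \<in> carrier_mat a n" "B \<in> carrier_mat b n" "C \<in> carrier_mat n c" "D \<in> carrier_mat n d"
  shows "(A @\<^sub>r B) * (C @\<^sub>c D) = four_block_mat (A * C) (A * D) (B * C) (B * D)"
proof -
  have "(A @\<^sub>r B) * (C @\<^sub>c D) = four_block_mat A (0\<^sub>m a 0) B (0\<^sub>m b 0) * four_block_mat C D (0\<^sub>m 0 c) (0\<^sub>m 0 d)"
    using assms by (simp add: append_cols_def append_rows_def)
  also have "\<dots> = four_block_mat (A * C) (A * D) (B * C) (B * D)"
    using assms by (subst mult_four_block_mat[of _ a n _ 0 _ b _ _ c _ d]) auto
  finally show ?thesis .
qed

lemma four_block_mat_mult_append_rows:
  fixes A :: "complex mat"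
  assumes "A \<in> carrier_mat a c" "B \<in> carrier_mat a d" "C \<in> carrier_mat b c" "D \<in> carrier_mat b d"
    and "X \<in> carrier_mat c n" "Y \<in> carrier_mat d n"
  shows "four_block_mat A B C D * (X @\<^sub>r Y) = (A * X + B * Y) @\<^sub>r (C * X + D * Y)"
proof -
  have "four_block_mat A B C D * (X @\<^sub>r Y) = four_block_mat A B C D * four_block_mat X (0\<^sub>m c 0) Y (0\<^sub>m d 0)"
    using assms by (simp add: append_rows_def)
  also have "\<dots> = (A * X + B * Y) @\<^sub>r (C * X + D * Y)"
    using assms by (subst mult_four_block_mat[of _ a c _ d _ b _ _ n _ 0]) (auto simp: append_rows_def)
  finally show ?thesis .
qed

lemma append_rows_add:
  fixes A :: "complex mat"
  assumes "A \<in> carrier_mat a n" "B \<in> carrier_mat b n" "C \<in> carrier_mat a n" "D \<in> carrier_mat b n"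
  shows "(A @\<^sub>r B) + (C @\<^sub>r D) = (A + C) @\<^sub>r (B + D)"
  using assms by (intro eq_matI) (auto simp: append_rows_def)

lemma append_rows_smult:
  fixes A :: "complex mat"
  assumes "A \<in> carrier_mat a n" "B \<in> carrier_mat b n"
  shows "x \<cdot>\<^sub>m (A @\<^sub>r B) = (x \<cdot>\<^sub>m A) @\<^sub>r (x \<cdot>\<^sub>m B)"
  using assms by (intro eq_matI) (auto simp: append_rows_def)

lemma append_rows_assoc:
  fixes A :: "complex mat"
  assumes "A \<in> carrier_mat a n" "B \<in> carrier_mat b n" "C \<in> carrier_mat c n"
  shows "(A @\<^sub>r B) @\<^sub>r C = A @\<^sub>r (B @\<^sub>r C)"
  using assms by (intro eq_matI) (auto simp: append_rows_def)

lemma four_block_mat_minus: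
  fixes A :: "complex mat"
  assumes "A \<in> carrier_mat a c" "B \<in> carrier_mat a d" "C \<in> carrier_mat b c" "D \<in> carrier_mat b d"
    and "A' \<in> carrier_mat a c" "B' \<in> carrier_mat a d" "C' \<in> carrier_mat b c" "D' \<in> carrier_mat b d"
  shows "four_block_mat A B C D - four_block_mat A' B' C' D' =
    four_block_mat (A - A') (B - B') (C - C') (D - D')"
  using assms by (intro eq_matI) (auto simp: minus_carrier_mat)

section \<open>Cancellation through the displacement identity\<close>

text \<open>The cancellation behind one block of the linear equation. With \<open>Z = R * V\<close>, the displacement
  identity between \<open>N * R\<close> and \<open>Z\<close> replaces \<open>\<i> * N * R * (P1 * Q2 + P3 * Q4) * Z\<close> by
  \<open>N * R * A * V - N * B * Z\<close>. Its second term meets \<open>D * N * Z\<close> in the intertwining relation, which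
  leaves \<open>\<i> * (F * Q2 + W) * Z\<close>, and its first term meets \<open>l * N * Z = l * N * R * V\<close> in the shift
  relation, which leaves \<open>N * R * P3 * X\<close>. The \<open>F\<close> and \<open>X\<close> terms are exactly the corrections in the
  statement, so only \<open>W\<close> survives.\<close>

lemma displacement_cancellation:
  assumes A: "A \<in> carrier_mat n n" and B: "B \<in> carrier_mat n n"
    and T: "T \<in> carrier_mat n n" and R: "R \<in> carrier_mat n n"
    and RT: "R * T = 1\<^sub>m n" and TR: "T * R = 1\<^sub>m n"
    and P1: "P1 \<in> carrier_mat n a" and P3: "P3 \<in> carrier_mat n a"
    and Q2: "Q2 \<in> carrier_mat a n" and Q4: "Q4 \<in> carrier_mat a n"
    and N: "N \<in> carrier_mat b n" and D: "D \<in> carrier_mat b b"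
    and F: "F \<in> carrier_mat b a" and W: "W \<in> carrier_mat b n"
    and V: "V \<in> carrier_mat n c" and X: "X \<in> carrier_mat a c"
    and displacement: "A * T - T * B = \<i> \<cdot>\<^sub>m (P1 * Q2 + P3 * Q4)"
    and intertwine: "D * N - N * B = \<i> \<cdot>\<^sub>m (F * Q2 + W)"
    and shift: "(A - l \<cdot>\<^sub>m 1\<^sub>m n) * V = P3 * X"
  shows "(D - l \<cdot>\<^sub>m 1\<^sub>m b) * (N * (R * V)) +
     \<i> \<cdot>\<^sub>m ((N * (R * P1) - F) * (Q2 * (R * V)) + N * (R * P3) * (Q4 * (R * V) + \<i> \<cdot>\<^sub>m X)) =
     \<i> \<cdot>\<^sub>m (W * (R * V))"
proof -
  define Z where "Z = R * V"
  have Z: "Z \<in> carrier_mat n c" using R V by (auto simp: Z_def)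
  have TZ: "T * Z = V"
    unfolding Z_def using assoc_mult_mat[OF T R V] TR V by simp
  have RTM: "R * (T * M) = M" if "M \<in> carrier_mat n c" for M
    using assoc_mult_mat[OF R T that] RT that by simp
  note m = mult_carrier_mat
  have AV: "A * V \<in> carrier_mat n c" and BZ: "B * Z \<in> carrier_mat n c"
    and Q2Z: "Q2 * Z \<in> carrier_mat a c" and Q4Z: "Q4 * Z \<in> carrier_mat a c"
    and NZ: "N * Z \<in> carrier_mat b c" using assms Z by auto
  have P1Z: "P1 * (Q2 * Z) \<in> carrier_mat n c" and P3Z: "P3 * (Q4 * Z) \<in> carrier_mat n c"
    and P3X: "P3 * X \<in> carrier_mat n c" using P1 P3 Q2Z Q4Z X by auto
  have "(A * T - T * B) * Z = A * V - T * (B * Z)"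
    using minus_mult_distrib_mat[OF m[OF A T] m[OF T B] Z]
      assoc_mult_mat[OF A T Z] assoc_mult_mat[OF T B Z] TZ by simp
  moreover have "(\<i> \<cdot>\<^sub>m (P1 * Q2 + P3 * Q4)) * Z = \<i> \<cdot>\<^sub>m (P1 * (Q2 * Z) + P3 * (Q4 * Z))"
    using mult_smult_assoc_mat[OF add_carrier_mat[OF m[OF P3 Q4]] Z, of \<i> "P1 * Q2"]
      add_mult_distrib_mat[OF m[OF P1 Q2] m[OF P3 Q4] Z]
      assoc_mult_mat[OF P1 Q2 Z] assoc_mult_mat[OF P3 Q4 Z] by simp
  ultimately have "A * V - T * (B * Z) = \<i> \<cdot>\<^sub>m (P1 * (Q2 * Z) + P3 * (Q4 * Z))"
    using displacement by simp
  then have "N * (R * (A * V - T * (B * Z))) = N * (R * (\<i> \<cdot>\<^sub>m (P1 * (Q2 * Z) + P3 * (Q4 * Z))))"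
    by simp
  then have 1: "N * (R * (A * V)) - N * (B * Z) =
      \<i> \<cdot>\<^sub>m (N * (R * (P1 * (Q2 * Z))) + N * (R * (P3 * (Q4 * Z))))"
    using mult_minus_distrib_mat[OF R AV m[OF T BZ]] RTM[OF BZ]
      mult_minus_distrib_mat[OF N m[OF R AV] BZ]
      mult_smult_distrib[OF R add_carrier_mat[OF P3Z], of \<i> "P1 * (Q2 * Z)"]
      mult_add_distrib_mat[OF R P1Z P3Z]
      mult_smult_distrib[OF N add_carrier_mat[OF m[OF R P3Z]], of \<i> "R * (P1 * (Q2 * Z))"]
      mult_add_distrib_mat[OF N m[OF R P1Z] m[OF R P3Z]] by simp
  have "(D * N - N * B) * Z = D * (N * Z) - N * (B * Z)"
    using minus_mult_distrib_mat[OF m[OF D N] m[OF N B] Z]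
      assoc_mult_mat[OF D N Z] assoc_mult_mat[OF N B Z] by simp
  moreover have "(\<i> \<cdot>\<^sub>m (F * Q2 + W)) * Z = \<i> \<cdot>\<^sub>m (F * (Q2 * Z) + W * Z)"
    using mult_smult_assoc_mat[OF add_carrier_mat[OF W] Z, of \<i> "F * Q2"]
      add_mult_distrib_mat[OF m[OF F Q2] W Z] assoc_mult_mat[OF F Q2 Z] by simp
  ultimately have 2: "D * (N * Z) - N * (B * Z) = \<i> \<cdot>\<^sub>m (F * (Q2 * Z) + W * Z)"
    using intertwine by simp
  have l1: "l \<cdot>\<^sub>m 1\<^sub>m k \<in> carrier_mat k k" for k by simp
  have "A * V - l \<cdot>\<^sub>m V = P3 * X"
    using minus_mult_distrib_mat[OF A l1 V] mult_smult_assoc_mat[OF one_carrier_mat V, of l] V shift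
    by simp
  then have "N * (R * (A * V - l \<cdot>\<^sub>m V)) = N * (R * (P3 * X))" by simp
  then have 3: "N * (R * (A * V)) - l \<cdot>\<^sub>m (N * Z) = N * (R * (P3 * X))"
    using mult_minus_distrib_mat[OF R AV, of "l \<cdot>\<^sub>m V"] V mult_smult_distrib[OF R V, of l]
      mult_minus_distrib_mat[OF N m[OF R AV], of "l \<cdot>\<^sub>m Z"] Z mult_smult_distrib[OF N Z, of l]
    by (simp add: Z_def)
  have 4: "(D - l \<cdot>\<^sub>m 1\<^sub>m b) * (N * Z) = D * (N * Z) - l \<cdot>\<^sub>m (N * Z)"
    using minus_mult_distrib_mat[OF D l1 NZ] mult_smult_assoc_mat[OF one_carrier_mat NZ, of l] left_mult_one_mat[OF NZ]
    by simp
  have 5: "(N * (R * P1) - F) * (Q2 * Z) = N * (R * (P1 * (Q2 * Z))) - F * (Q2 * Z)"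
    using minus_mult_distrib_mat[OF m[OF N m[OF R P1]] F Q2Z]
      assoc_mult_mat[OF N m[OF R P1] Q2Z] assoc_mult_mat[OF R P1 Q2Z] by simp
  have 6: "N * (R * P3) * (Q4 * Z + \<i> \<cdot>\<^sub>m X) = N * (R * (P3 * (Q4 * Z))) + \<i> \<cdot>\<^sub>m (N * (R * (P3 * X)))"
    using mult_add_distrib_mat[OF m[OF N m[OF R P3]] Q4Z, of "\<i> \<cdot>\<^sub>m X"] X
      mult_smult_distrib[OF m[OF N m[OF R P3]] X, of \<i>]
      assoc_mult_mat[OF N m[OF R P3] Q4Z] assoc_mult_mat[OF R P3 Q4Z]
      assoc_mult_mat[OF N m[OF R P3] X] assoc_mult_mat[OF R P3 X] by simp
  define d where "d = D * (N * Z)" define z where "z = N * Z"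
  define p where "p = N * (R * (P1 * (Q2 * Z)))" define q where "q = N * (R * (P3 * (Q4 * Z)))"
  define f where "f = F * (Q2 * Z)" define w where "w = W * Z"
  define x where "x = N * (R * (P3 * X))" define k where "k = N * (B * Z)"
  define e where "e = N * (R * (A * V))"
  note defs = d_def z_def p_def q_def f_def w_def x_def k_def e_def
  have car: "d \<in> carrier_mat b c" "z \<in> carrier_mat b c" "p \<in> carrier_mat b c" "q \<in> carrier_mat b c"
    "f \<in> carrier_mat b c" "w \<in> carrier_mat b c" "x \<in> carrier_mat b c" "k \<in> carrier_mat b c"
    "e \<in> carrier_mat b c"
    unfolding defs
    using m[OF D NZ] NZ m[OF N m[OF R P1Z]] m[OF N m[OF R P3Z]] m[OF F Q2Z] m[OF W Z]
      m[OF N m[OF R P3X]] m[OF N BZ] m[OF N m[OF R AV]] by auto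
  \<comment> \<open>All terms now have equal size, and the claim is a linear consequence of three relations,
    checked entry by entry; \<open>\<i> * \<i> = - 1\<close> gives the term with \<open>x\<close> its sign.\<close>
  have eqs: "e - k = \<i> \<cdot>\<^sub>m (p + q)" "d - k = \<i> \<cdot>\<^sub>m (f + w)" "e - l \<cdot>\<^sub>m z = x"
    using 1 2 3 by (simp_all add: defs)
  have "(d - l \<cdot>\<^sub>m z) + \<i> \<cdot>\<^sub>m ((p - f) + (q + \<i> \<cdot>\<^sub>m x)) = \<i> \<cdot>\<^sub>m w"
  proof (rule eq_matI, goal_cases)
    case (1 i j)
    then have ij: "i < b" "j < c" using car by auto
    have "(e - k) $$ (i, j) = (\<i> \<cdot>\<^sub>m (p + q)) $$ (i, j)" "(d - k) $$ (i, j) = (\<i> \<cdot>\<^sub>m (f + w)) $$ (i, j)"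
      "(e - l \<cdot>\<^sub>m z) $$ (i, j) = x $$ (i, j)"
      using eqs by auto
    then have E: "e $$ (i, j) - k $$ (i, j) = \<i> * (p $$ (i, j) + q $$ (i, j))"
      "d $$ (i, j) - k $$ (i, j) = \<i> * (f $$ (i, j) + w $$ (i, j))"
      "e $$ (i, j) - l * z $$ (i, j) = x $$ (i, j)"
      using ij car by auto
    have "d $$ (i, j) - l * z $$ (i, j) + \<i> * ((p $$ (i, j) - f $$ (i, j)) + (q $$ (i, j) + \<i> * x $$ (i, j))) =
        (d $$ (i, j) - \<i> * f $$ (i, j)) + \<i> * (p $$ (i, j) + q $$ (i, j)) - l * z $$ (i, j) - x $$ (i, j)"
      by (simp add: algebra_simps flip: mult.assoc)
    also have "\<dots> = \<i> * w $$ (i, j)"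
      unfolding E(1)[symmetric] E(3)[symmetric] using E(2) by (simp add: algebra_simps)
    finally show ?case using ij car by auto
  qed (use car in auto)
  then show ?thesis
    unfolding Z_def[symmetric] 4 5 6 by (simp add: defs)
qed

text \<open>One half of the rows of the linear equation in abstract form: \<open>displacement_cancellation\<close> for both
  blocks \<open>N2\<close> and \<open>N4\<close> of a matrix in the role of \<open>Pihat\<close>, where the remainder \<open>W\<close> is \<open>0\<close> for \<open>N2\<close> and
  \<open>L * K\<close> for \<open>N4\<close>. The tail \<open>Y\<close> adds the constant term that completes \<open>K * (R * V)\<close> to
  the matrix in the role of \<open>theta\<close>.\<close>

lemma displacement_block_row:
  assumes A: "A \<in> carrier_mat n n" and B: "B \<in> carrier_mat n n"
    and T: "T \<in> carrier_mat n n" and R: "R \<in> carrier_mat n n"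
    and RT: "R * T = 1\<^sub>m n" and TR: "T * R = 1\<^sub>m n"
    and P1: "P1 \<in> carrier_mat n a" and P3: "P3 \<in> carrier_mat n a"
    and Q2: "Q2 \<in> carrier_mat a n" and Q4: "Q4 \<in> carrier_mat a n"
    and N2: "N2 \<in> carrier_mat b n" and N4: "N4 \<in> carrier_mat b n" and D: "D \<in> carrier_mat b b"
    and F2: "F2 \<in> carrier_mat b a" and F4: "F4 \<in> carrier_mat b a"
    and L: "L \<in> carrier_mat b c" and K: "K \<in> carrier_mat c n"
    and V: "V \<in> carrier_mat n c" and X: "X \<in> carrier_mat a c" and Y: "Y \<in> carrier_mat b c"
    and displacement: "A * T - T * B = \<i> \<cdot>\<^sub>m (P1 * Q2 + P3 * Q4)"
    and intertwine2: "D * N2 - N2 * B = \<i> \<cdot>\<^sub>m (F2 * Q2)"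
    and intertwine4: "D * N4 - N4 * B = \<i> \<cdot>\<^sub>m (F4 * Q2 + L * K)"
    and shift: "(A - l \<cdot>\<^sub>m 1\<^sub>m n) * V = P3 * X"
    and tail: "(D - l \<cdot>\<^sub>m 1\<^sub>m b) * Y = L"
  shows "four_block_mat (D - l \<cdot>\<^sub>m 1\<^sub>m b) (0\<^sub>m b b) (0\<^sub>m b b) (D - l \<cdot>\<^sub>m 1\<^sub>m b) *
       (N2 * (R * V) @\<^sub>r (N4 * (R * V) + \<i> \<cdot>\<^sub>m Y)) +
     (\<i> \<cdot>\<^sub>m ((N2 @\<^sub>r N4) * (R * (P1 @\<^sub>c P3)) - four_block_mat F2 (0\<^sub>m b a) F4 (0\<^sub>m b a))) *
       (Q2 * (R * V) @\<^sub>r (Q4 * (R * V) + \<i> \<cdot>\<^sub>m X)) =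
     0\<^sub>m b c @\<^sub>r L * (\<i> \<cdot>\<^sub>m (1\<^sub>m c + K * (R * V)))"
proof -
  note m = mult_carrier_mat
  define Z where "Z = R * V"
  define E where "E = D - l \<cdot>\<^sub>m 1\<^sub>m b"
  define U where "U = Q4 * Z + \<i> \<cdot>\<^sub>m X"
  have Z: "Z \<in> carrier_mat n c" using R V by (auto simp: Z_def)
  have E: "E \<in> carrier_mat b b" using D by (simp add: E_def minus_carrier_mat)
  have Q2Z: "Q2 * Z \<in> carrier_mat a c" and U: "U \<in> carrier_mat a c"
    and NZ: "N2 * Z \<in> carrier_mat b c" "N4 * Z \<in> carrier_mat b c" and LK: "L * K \<in> carrier_mat b n"
    and RP: "R * P1 \<in> carrier_mat n a" "R * P3 \<in> carrier_mat n a" using assms Z by (auto simp: U_def)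
  have NR: "N2 * (R * P1) \<in> carrier_mat b a" "N2 * (R * P3) \<in> carrier_mat b a"
    "N4 * (R * P1) \<in> carrier_mat b a" "N4 * (R * P3) \<in> carrier_mat b a"
    using m[OF N2 RP(1)] m[OF N2 RP(2)] m[OF N4 RP(1)] m[OF N4 RP(2)] by auto
  define S2 where "S2 = (N2 * (R * P1) - F2) * (Q2 * Z) + N2 * (R * P3) * U"
  define S4 where "S4 = (N4 * (R * P1) - F4) * (Q2 * Z) + N4 * (R * P3) * U"
  have NF: "N2 * (R * P1) - F2 \<in> carrier_mat b a" "N4 * (R * P1) - F4 \<in> carrier_mat b a"
    using F2 F4 by (simp_all add: minus_carrier_mat)
  have S: "S2 \<in> carrier_mat b c" "S4 \<in> carrier_mat b c"
    unfolding S2_def S4_def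
    using m[OF NF(1) Q2Z] m[OF NF(2) Q2Z] m[OF NR(2) U] m[OF NR(4) U] by auto
  have minus_0: "M - 0\<^sub>m b a = M" if "M \<in> carrier_mat b a" for M :: "complex mat"
    using that by (intro eq_matI) auto
  have "(N2 @\<^sub>r N4) * (R * (P1 @\<^sub>c P3)) - four_block_mat F2 (0\<^sub>m b a) F4 (0\<^sub>m b a) =
      four_block_mat (N2 * (R * P1) - F2) (N2 * (R * P3)) (N4 * (R * P1) - F4) (N4 * (R * P3))"
    using NR F2 F4
    by (simp add: mult_append_cols[OF R P1 P3] append_rows_mult_append_cols[OF N2 N4 RP]
        four_block_mat_minus[OF NR F2 zero_carrier_mat F4 zero_carrier_mat] minus_0 NR)
  then have G: "(\<i> \<cdot>\<^sub>m ((N2 @\<^sub>r N4) * (R * (P1 @\<^sub>c P3)) - four_block_mat F2 (0\<^sub>m b a) F4 (0\<^sub>m b a))) *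
       (Q2 * Z @\<^sub>r U) = \<i> \<cdot>\<^sub>m S2 @\<^sub>r \<i> \<cdot>\<^sub>m S4"
    using mult_smult_assoc_mat[OF four_block_carrier_mat[OF NF(1) NR(4)] carrier_append_rows[OF Q2Z U]]
      four_block_mat_mult_append_rows[OF NF(1) NR(2) NF(2) NR(4) Q2Z U] append_rows_smult[OF S]
    by (simp add: S2_def S4_def)
  have z: "0\<^sub>m b b \<in> carrier_mat b b" by simp
  have iY: "\<i> \<cdot>\<^sub>m Y \<in> carrier_mat b c" using Y by simp
  have N4Y: "N4 * Z + \<i> \<cdot>\<^sub>m Y \<in> carrier_mat b c" using iY by simp
  have "E * (N4 * Z + \<i> \<cdot>\<^sub>m Y) = E * (N4 * Z) + \<i> \<cdot>\<^sub>m L"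
    using mult_add_distrib_mat[OF E NZ(2) iY] mult_smult_distrib[OF E Y, of \<i>] tail
    by (simp add: E_def)
  then have D': "four_block_mat E (0\<^sub>m b b) (0\<^sub>m b b) E * (N2 * Z @\<^sub>r (N4 * Z + \<i> \<cdot>\<^sub>m Y)) =
      E * (N2 * Z) @\<^sub>r (E * (N4 * Z) + \<i> \<cdot>\<^sub>m L)"
    using four_block_mat_mult_append_rows[OF E z z E NZ(1) N4Y] m[OF E NZ(1)] m[OF E NZ(2)] L
      left_mult_zero_mat[OF N4Y, of b] left_mult_zero_mat[OF NZ(1), of b] by simp
  have top: "E * (N2 * Z) + \<i> \<cdot>\<^sub>m S2 = 0\<^sub>m b c"
  proof -
    have "D * N2 - N2 * B = \<i> \<cdot>\<^sub>m (F2 * Q2 + 0\<^sub>m b n)"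
      using intertwine2 m[OF F2 Q2] by simp
    from displacement_cancellation[OF A B T R RT TR P1 P3 Q2 Q4 N2 D F2 zero_carrier_mat V X displacement this shift]
    show ?thesis using left_mult_zero_mat[OF Z, of b]
      by (simp add: Z_def E_def S2_def U_def smult_zero_mat)
  qed
  have bot: "(E * (N4 * Z) + \<i> \<cdot>\<^sub>m L) + \<i> \<cdot>\<^sub>m S4 = L * (\<i> \<cdot>\<^sub>m (1\<^sub>m c + K * Z))"
  proof -
    have "E * (N4 * Z) + \<i> \<cdot>\<^sub>m S4 = \<i> \<cdot>\<^sub>m (L * (K * Z))"
      using displacement_cancellation[OF A B T R RT TR P1 P3 Q2 Q4 N4 D F4 LK V X displacement intertwine4 shift]
        assoc_mult_mat[OF L K Z]
      by (simp add: Z_def E_def S4_def U_def)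
    moreover have "L * (\<i> \<cdot>\<^sub>m (1\<^sub>m c + K * Z)) = \<i> \<cdot>\<^sub>m (L + L * (K * Z))"
      using mult_smult_distrib[OF L add_carrier_mat[OF m[OF K Z]], of \<i> "1\<^sub>m c"]
        mult_add_distrib_mat[OF L one_carrier_mat m[OF K Z]] right_mult_one_mat[OF L] by simp
    moreover have "\<i> \<cdot>\<^sub>m (L + L * (K * Z)) = \<i> \<cdot>\<^sub>m (L * (K * Z)) + \<i> \<cdot>\<^sub>m L"
      using add_smult_distrib_left_mat[OF L m[OF L m[OF K Z]], of \<i>] L m[OF L m[OF K Z]]
      by (simp add: comm_add_mat[of _ b c])
    moreover have "(E * (N4 * Z) + \<i> \<cdot>\<^sub>m L) + \<i> \<cdot>\<^sub>m S4 = (E * (N4 * Z) + \<i> \<cdot>\<^sub>m S4) + \<i> \<cdot>\<^sub>m L"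
      using m[OF E NZ(2)] L S by (intro eq_matI) auto
    ultimately show ?thesis by simp
  qed
  have "E * (N4 * Z) + \<i> \<cdot>\<^sub>m L \<in> carrier_mat b c" using L by simp
  from append_rows_add[OF m[OF E NZ(1)] this, of "\<i> \<cdot>\<^sub>m S2" "\<i> \<cdot>\<^sub>m S4"] S show ?thesis
    unfolding Z_def[symmetric] E_def[symmetric] U_def[symmetric] D' G by (simp add: top bot)
qed

section \<open>Displacement and intertwining identities of a block TBT-matrix\<close>

lemma TBT_block_carrier [simp]: "TBT_block m2 m3 t r \<in> carrier_mat (m2 * m3) (m2 * m3)"
  by (simp add: TBT_block_def)

lemma M12_block_carrier [simp]: "M12_block m2 m3 t r \<in> carrier_mat (m2 * m3) m3"
  using block_mat_carrier[of m2 1 m3 m3] by (simp add: M12_block_def del: block_mat_carrier)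

lemma M42_block_carrier [simp]: "M42_block m2 m3 t r \<in> carrier_mat m3 (m2 * m3)"
  using block_mat_carrier[of 1 m2 m3 m3] by (simp add: M42_block_def del: block_mat_carrier)

lemma Lcol_carrier [simp]: "Lcol n m3 \<in> carrier_mat (n * m3) m3"
  using kron_carrier[OF ones_carrier(1) one_carrier_mat, of n m3] by (simp add: Lcol_def)

lemma adjoint_Lcol: "mat_adjoint (Lcol n m3) = mat_adjoint (ones n) \<otimes>\<^sub>K 1\<^sub>m m3"
  by (simp add: Lcol_def mat_adjoint_kron)

text \<open>In the following forms each of the two Toeplitz directions occupies one outer Kronecker slot, so that
  \<open>kron_mult_kron\<close> applies.\<close>

lemma M22_eq: "M22 m1 m2 m3 = 1\<^sub>m m1 \<otimes>\<^sub>K mat_adjoint (Lcol m2 m3)"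
  by (simp add: M22_def kron_assoc adjoint_Lcol)

lemma M32_eq: "M32 m1 m2 m3 = 1\<^sub>m m1 \<otimes>\<^sub>K Lcol m2 m3"
  by (simp add: M32_def M22_eq mat_adjoint_kron)

lemma M31_eq: "M31 m1 m2 m3 = ones m1 \<otimes>\<^sub>K 1\<^sub>m (m2 * m3)"
  by (simp add: M31_def M21_def mat_adjoint_kron)

lemma A1_eq: "A1 m1 m2 m3 = calA m1 \<otimes>\<^sub>K 1\<^sub>m (m2 * m3)"
  by (simp add: A1_def kron_assoc one_kron_one)

lemma A2_eq: "A2 m1 m2 m3 = 1\<^sub>m m1 \<otimes>\<^sub>K (calA m2 \<otimes>\<^sub>K 1\<^sub>m m3)"
  by (simp add: A2_def kron_assoc)

lemma M_carriers [simp]: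
  "M11 m1 m2 m3 t \<in> carrier_mat (m1 * (m2 * m3)) (m2 * m3)"
  "M21 m1 m2 m3 \<in> carrier_mat (m2 * m3) (m1 * (m2 * m3))"
  "M31 m1 m2 m3 \<in> carrier_mat (m1 * (m2 * m3)) (m2 * m3)"
  "M41 m1 m2 m3 t \<in> carrier_mat (m2 * m3) (m1 * (m2 * m3))"
  "M12 m1 m2 m3 t \<in> carrier_mat (m1 * (m2 * m3)) (m1 * m3)"
  "M22 m1 m2 m3 \<in> carrier_mat (m1 * m3) (m1 * (m2 * m3))"
  "M32 m1 m2 m3 \<in> carrier_mat (m1 * (m2 * m3)) (m1 * m3)"
  "M42 m1 m2 m3 t \<in> carrier_mat (m1 * m3) (m1 * (m2 * m3))"
  "K11 m1 m2 m3 t \<in> carrier_mat (m1 * m3) (m2 * m3)"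
  "K12 m1 m2 m3 t \<in> carrier_mat (m2 * m3) (m1 * m3)"
  "Kmat m1 m2 m3 t \<in> carrier_mat m3 (m1 * (m2 * m3))"
  "A1 m1 m2 m3 \<in> carrier_mat (m1 * (m2 * m3)) (m1 * (m2 * m3))"
  "A2 m1 m2 m3 \<in> carrier_mat (m1 * (m2 * m3)) (m1 * (m2 * m3))"
  "TBT m1 m2 m3 t \<in> carrier_mat (m1 * (m2 * m3)) (m1 * (m2 * m3))"
  by (auto intro!: carrier_matI simp: M11_def M21_def M31_def M41_def M12_def M22_def M32_def M42_def
      K11_def K12_def Kmat_def A1_def A2_def TBT_def toeplitz_def ones_def calA_def)

lemma displacement1:
  "A1 m1 m2 m3 * TBT m1 m2 m3 t - TBT m1 m2 m3 t * mat_adjoint (A1 m1 m2 m3) =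
   \<i> \<cdot>\<^sub>m (M11 m1 m2 m3 t * M21 m1 m2 m3 + M31 m1 m2 m3 * M41 m1 m2 m3 t)"
  unfolding A1_eq TBT_def M11_def M21_def M31_eq M41_def mat_adjoint_kron mat_adjoint_one
  by (rule toeplitz_identity) simp

text \<open>The inner Toeplitz structure of a single block; the two lemmas on the direction \<open>A2\<close> that use
  it apply it to all blocks of \<open>TBT\<close> and to all half sums of blocks in \<open>M41\<close>.\<close>

lemma displacement_block:
  assumes t: "\<And>s. \<bar>s\<bar> < int m2 \<Longrightarrow> t r s \<in> carrier_mat m3 m3"
  shows "(calA m2 \<otimes>\<^sub>K 1\<^sub>m m3) * TBT_block m2 m3 t r - TBT_block m2 m3 t r * (mat_adjoint (calA m2) \<otimes>\<^sub>K 1\<^sub>m m3) =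
    \<i> \<cdot>\<^sub>m (M12_block m2 m3 t r * mat_adjoint (Lcol m2 m3) + Lcol m2 m3 * M42_block m2 m3 t r)"
  unfolding TBT_block_def M12_block_def M42_block_def adjoint_Lcol unfolding Lcol_def
  by (rule toeplitz_identity) (rule t)

lemma displacement2:
  assumes t: "\<And>r s. \<bar>r\<bar> < int m1 \<Longrightarrow> \<bar>s\<bar> < int m2 \<Longrightarrow> t r s \<in> carrier_mat m3 m3"
  shows "A2 m1 m2 m3 * TBT m1 m2 m3 t - TBT m1 m2 m3 t * mat_adjoint (A2 m1 m2 m3) =
   \<i> \<cdot>\<^sub>m (M12 m1 m2 m3 t * M22 m1 m2 m3 + M32 m1 m2 m3 * M42 m1 m2 m3 t)"
proof -
  let ?D = "calA m2 \<otimes>\<^sub>K 1\<^sub>m m3" and ?D' = "mat_adjoint (calA m2) \<otimes>\<^sub>K 1\<^sub>m m3"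
  let ?L = "Lcol m2 m3" and ?m = "m2 * m3"
  have D: "?D \<in> carrier_mat ?m ?m" "?D' \<in> carrier_mat ?m ?m" by simp_all
  have L: "mat_adjoint ?L \<in> carrier_mat m3 ?m" by simp
  note m = mult_carrier_mat
  have "A2 m1 m2 m3 * TBT m1 m2 m3 t - TBT m1 m2 m3 t * mat_adjoint (A2 m1 m2 m3) =
    block_mat m1 m1 ?m ?m (\<lambda>i k. ?D * TBT_block m2 m3 t (int i - int k) - TBT_block m2 m3 t (int i - int k) * ?D')"
    unfolding A2_eq TBT_def toeplitz_def mat_adjoint_kron mat_adjoint_one
      one_kron_mult_block_mat[OF D(1) TBT_block_carrier] block_mat_mult_one_kron[OF D(2) TBT_block_carrier]
    by (rule block_mat_minus[OF m[OF D(1) TBT_block_carrier] m[OF TBT_block_carrier D(2)]])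
  also have "\<dots> = block_mat m1 m1 ?m ?m (\<lambda>i k. \<i> \<cdot>\<^sub>m (M12_block m2 m3 t (int i - int k) * mat_adjoint ?L +
      ?L * M42_block m2 m3 t (int i - int k)))"
    by (rule block_mat_cong, rule displacement_block) (auto intro: t)
  also have "\<dots> = \<i> \<cdot>\<^sub>m (M12 m1 m2 m3 t * M22 m1 m2 m3 + M32 m1 m2 m3 * M42 m1 m2 m3 t)"
    unfolding M12_def M22_eq M32_eq M42_def toeplitz_def
      one_kron_mult_block_mat[OF Lcol_carrier M42_block_carrier] block_mat_mult_one_kron[OF L M12_block_carrier]
    by (subst block_mat_add[OF m[OF M12_block_carrier L] m[OF Lcol_carrier M42_block_carrier]],
        subst block_mat_smult) (auto intro!: add_carrier_mat m[OF Lcol_carrier M42_block_carrier])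
  finally show ?thesis .
qed

text \<open>All matrices in \<open>intertwine21\<close> and \<open>intertwine22\<close> are Kronecker products in which the factor
  \<open>calA\<close> and the summing row act on different slots, so that the two matrices on the left differ only
  in \<open>calA\<close> against its adjoint: the identities are \<open>calA_minus_adjoint\<close> in one slot.\<close>

lemma intertwine21:
  "(calA m2 \<otimes>\<^sub>K 1\<^sub>m m3) * M21 m1 m2 m3 - M21 m1 m2 m3 * mat_adjoint (A2 m1 m2 m3) =
   \<i> \<cdot>\<^sub>m (Lcol m2 m3 * mat_adjoint (Lcol m1 m3) * M22 m1 m2 m3)"
proof -
  let ?D = "calA m2 \<otimes>\<^sub>K 1\<^sub>m m3" and ?L = "Lcol m2 m3" and ?m = "m2 * m3" and ?o = "mat_adjoint (ones m1)"
  have D: "?D \<in> carrier_mat ?m ?m" "mat_adjoint ?D \<in> carrier_mat ?m ?m" by simp_all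
  have L: "?L \<in> carrier_mat ?m m3" "mat_adjoint ?L \<in> carrier_mat m3 ?m" by simp_all
  have L1: "mat_adjoint (Lcol m1 m3) \<in> carrier_mat m3 (m1 * m3)" by simp
  have o: "?o \<in> carrier_mat 1 m1" by simp
  have DD: "?D - mat_adjoint ?D = \<i> \<cdot>\<^sub>m (?L * mat_adjoint ?L)"
  proof -
    have "?D - mat_adjoint ?D = (calA m2 - mat_adjoint (calA m2)) \<otimes>\<^sub>K 1\<^sub>m m3"
      by (simp add: mat_adjoint_kron kron_minus_left[of _ m2 m2])
    also have "\<dots> = \<i> \<cdot>\<^sub>m ((ones m2 * mat_adjoint (ones m2)) \<otimes>\<^sub>K (1\<^sub>m m3 * 1\<^sub>m m3))"
      by (simp add: calA_minus_adjoint kron_smult_left)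
    also have "(ones m2 * mat_adjoint (ones m2)) \<otimes>\<^sub>K (1\<^sub>m m3 * 1\<^sub>m m3) = ?L * mat_adjoint ?L"
      unfolding adjoint_Lcol unfolding Lcol_def
      by (rule kron_mult_kron[OF ones_carrier(1) one_carrier_mat mat_adjoint_carrier[OF ones_carrier(1)]
            one_carrier_mat, symmetric])
    finally show ?thesis .
  qed
  have "?D * M21 m1 m2 m3 = (1\<^sub>m 1 \<otimes>\<^sub>K ?D) * (?o \<otimes>\<^sub>K 1\<^sub>m ?m)"
    by (simp add: one1_kron M21_def)
  also have "\<dots> = ?o \<otimes>\<^sub>K ?D"
    using kron_mult_kron[OF one_carrier_mat D(1) o one_carrier_mat] left_mult_one_mat[OF o]
      right_mult_one_mat[OF D(1)] by simp
  finally have 1: "?D * M21 m1 m2 m3 = ?o \<otimes>\<^sub>K ?D" .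
  have 2: "M21 m1 m2 m3 * mat_adjoint (A2 m1 m2 m3) = ?o \<otimes>\<^sub>K mat_adjoint ?D"
    unfolding M21_def A2_eq mat_adjoint_kron[of _ ?D] mat_adjoint_one
    using kron_mult_kron[OF o one_carrier_mat one_carrier_mat D(2)] right_mult_one_mat[OF o]
      left_mult_one_mat[OF D(2)] by simp
  have "mat_adjoint (Lcol m1 m3) * M22 m1 m2 m3 = ?o \<otimes>\<^sub>K mat_adjoint ?L"
    unfolding adjoint_Lcol[of m1] M22_eq
    using kron_mult_kron[OF o one_carrier_mat one_carrier_mat L(2)] right_mult_one_mat[OF o]
      left_mult_one_mat[OF L(2)] by simp
  then have "?L * mat_adjoint (Lcol m1 m3) * M22 m1 m2 m3 = (1\<^sub>m 1 \<otimes>\<^sub>K ?L) * (?o \<otimes>\<^sub>K mat_adjoint ?L)"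
    using assoc_mult_mat[OF L(1) L1 M_carriers(6)] by (simp add: one1_kron)
  also have "\<dots> = ?o \<otimes>\<^sub>K (?L * mat_adjoint ?L)"
    using kron_mult_kron[OF one_carrier_mat L(1) o L(2)] left_mult_one_mat[OF o] by simp
  finally have 3: "?L * mat_adjoint (Lcol m1 m3) * M22 m1 m2 m3 = ?o \<otimes>\<^sub>K (?L * mat_adjoint ?L)" .
  show ?thesis
    unfolding 1 2 3 kron_minus_right[OF D, symmetric] DD kron_smult_right ..
qed

text \<open>The blocks of \<open>M41\<close> are half sums of the blocks of \<open>TBT\<close> and inherit their displacement identity by
  linearity; the half sums of its right-hand side are by definition the blocks of \<open>K12\<close> and \<open>Kmat\<close>.\<close>

lemma intertwine41:
  assumes t: "\<And>r s. \<bar>r\<bar> < int m1 \<Longrightarrow> \<bar>s\<bar> < int m2 \<Longrightarrow> t r s \<in> carrier_mat m3 m3"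
  shows "(calA m2 \<otimes>\<^sub>K 1\<^sub>m m3) * M41 m1 m2 m3 t - M41 m1 m2 m3 t * mat_adjoint (A2 m1 m2 m3) =
   \<i> \<cdot>\<^sub>m (K12 m1 m2 m3 t * M22 m1 m2 m3 + Lcol m2 m3 * Kmat m1 m2 m3 t)"
proof -
  let ?D = "calA m2 \<otimes>\<^sub>K 1\<^sub>m m3" and ?D' = "mat_adjoint (calA m2) \<otimes>\<^sub>K 1\<^sub>m m3"
  let ?L = "Lcol m2 m3" and ?m = "m2 * m3"
  let ?T = "\<lambda>s. TBT_block m2 m3 t (- s)" and ?P = "\<lambda>s. M12_block m2 m3 t (- s)"
  let ?Q = "\<lambda>s. M42_block m2 m3 t (- s)"
  have D: "?D \<in> carrier_mat ?m ?m" "?D' \<in> carrier_mat ?m ?m" by simp_all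
  have L: "?L \<in> carrier_mat ?m m3" "mat_adjoint ?L \<in> carrier_mat m3 ?m" by simp_all
  note m = mult_carrier_mat
  have hT: "half_sum ?T k \<in> carrier_mat ?m ?m" for k by simp
  have hP: "half_sum ?P k \<in> carrier_mat ?m m3" for k by simp
  have hQ: "half_sum ?Q k \<in> carrier_mat m3 ?m" for k by simp
  have half: "?D * half_sum ?T k - half_sum ?T k * ?D' =
      \<i> \<cdot>\<^sub>m (half_sum ?P k * mat_adjoint ?L + ?L * half_sum ?Q k)" if "k < m1" for k
  proof -
    have "half_sum (\<lambda>s. ?D * ?T s - ?T s * ?D') k =
        half_sum (\<lambda>s. ?D * ?T s) k - half_sum (\<lambda>s. ?T s * ?D') k"
      by (rule half_sum_minus[OF m[OF D(1) TBT_block_carrier] m[OF TBT_block_carrier D(2)]])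
    then have "?D * half_sum ?T k - half_sum ?T k * ?D' = half_sum (\<lambda>s. ?D * ?T s - ?T s * ?D') k"
      using half_sum_mult_left[OF D(1), of k ?T ?m] half_sum_mult_right[OF D(2), of k ?T ?m] by simp
    also have "\<dots> = half_sum (\<lambda>s. \<i> \<cdot>\<^sub>m (?P s * mat_adjoint ?L + ?L * ?Q s)) k"
      by (rule half_sum_cong, rule displacement_block) (use that in \<open>auto intro: t\<close>)
    also have "\<dots> = \<i> \<cdot>\<^sub>m half_sum (\<lambda>s. ?P s * mat_adjoint ?L + ?L * ?Q s) k"
      by (rule half_sum_smult[of _ _ ?m ?m]) (intro add_carrier_mat m[OF L(1)] M42_block_carrier)
    also have "half_sum (\<lambda>s. ?P s * mat_adjoint ?L + ?L * ?Q s) k =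
        half_sum (\<lambda>s. ?P s * mat_adjoint ?L) k + half_sum (\<lambda>s. ?L * ?Q s) k"
      by (rule half_sum_add[OF m[OF M12_block_carrier L(2)] m[OF L(1) M42_block_carrier]])
    also have "\<dots> = half_sum ?P k * mat_adjoint ?L + ?L * half_sum ?Q k"
      using half_sum_mult_left[OF L(1), of k ?Q ?m] half_sum_mult_right[OF L(2), of k ?P ?m] by simp
    finally show ?thesis .
  qed
  have "?D * M41 m1 m2 m3 t - M41 m1 m2 m3 t * mat_adjoint (A2 m1 m2 m3) =
      block_row m1 ?m ?m (\<lambda>k. ?D * half_sum ?T k - half_sum ?T k * ?D')"
  proof -
    have "?D * M41 m1 m2 m3 t = block_row m1 ?m ?m (\<lambda>k. ?D * half_sum ?T k)"
      using one_kron_mult_block_mat[OF D(1), of 1 m1 "\<lambda>_. half_sum ?T" ?m]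
      by (simp add: M41_def one1_kron)
    moreover have "M41 m1 m2 m3 t * mat_adjoint (A2 m1 m2 m3) =
        block_row m1 ?m ?m (\<lambda>k. half_sum ?T k * ?D')"
      using block_mat_mult_one_kron[OF D(2), of 1 m1 "\<lambda>_. half_sum ?T" ?m]
      by (simp add: M41_def A2_eq mat_adjoint_kron)
    moreover have "block_row m1 ?m ?m (\<lambda>k. ?D * half_sum ?T k) - block_row m1 ?m ?m (\<lambda>k. half_sum ?T k * ?D') =
        block_row m1 ?m ?m (\<lambda>k. ?D * half_sum ?T k - half_sum ?T k * ?D')"
      by (rule block_mat_minus[OF m[OF D(1) hT] m[OF hT D(2)]])
    ultimately show ?thesis by simp
  qed
  also have "\<dots> = block_row m1 ?m ?m (\<lambda>k. \<i> \<cdot>\<^sub>m (half_sum ?P k * mat_adjoint ?L + ?L * half_sum ?Q k))"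
    by (rule block_mat_cong) (rule half)
  also have "\<dots> = \<i> \<cdot>\<^sub>m (K12 m1 m2 m3 t * M22 m1 m2 m3 + Lcol m2 m3 * Kmat m1 m2 m3 t)"
  proof -
    have "K12 m1 m2 m3 t * M22 m1 m2 m3 = block_row m1 ?m ?m (\<lambda>k. half_sum ?P k * mat_adjoint ?L)"
      using block_mat_mult_one_kron[OF L(2), of 1 m1 "\<lambda>_. half_sum ?P" ?m]
      by (simp add: K12_def M22_eq)
    moreover have "?L * Kmat m1 m2 m3 t = block_row m1 ?m ?m (\<lambda>k. ?L * half_sum ?Q k)"
      using one_kron_mult_block_mat[OF L(1), of 1 m1 "\<lambda>_. half_sum ?Q" ?m]
      by (simp add: Kmat_def one1_kron)
    moreover have "block_row m1 ?m ?m (\<lambda>k. half_sum ?P k * mat_adjoint ?L) +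
        block_row m1 ?m ?m (\<lambda>k. ?L * half_sum ?Q k) =
        block_row m1 ?m ?m (\<lambda>k. half_sum ?P k * mat_adjoint ?L + ?L * half_sum ?Q k)"
      by (rule block_mat_add[OF m[OF hP L(2)] m[OF L(1) hQ]])
    moreover have "\<i> \<cdot>\<^sub>m block_row m1 ?m ?m (\<lambda>k. half_sum ?P k * mat_adjoint ?L + ?L * half_sum ?Q k) =
        block_row m1 ?m ?m (\<lambda>k. \<i> \<cdot>\<^sub>m (half_sum ?P k * mat_adjoint ?L + ?L * half_sum ?Q k))"
      by (rule block_mat_smult[OF add_carrier_mat[OF m[OF L(1) hQ]]])
    ultimately show ?thesis by simp
  qed
  finally show ?thesis .
qed

lemma intertwine22:
  "(calA m1 \<otimes>\<^sub>K 1\<^sub>m m3) * M22 m1 m2 m3 - M22 m1 m2 m3 * mat_adjoint (A1 m1 m2 m3) =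
   \<i> \<cdot>\<^sub>m (Lcol m1 m3 * mat_adjoint (Lcol m2 m3) * M21 m1 m2 m3)"
proof -
  let ?L = "Lcol m2 m3" and ?m = "m2 * m3" and ?o = "mat_adjoint (ones m1)"
  have L: "mat_adjoint ?L \<in> carrier_mat m3 ?m" by simp
  have L1: "Lcol m1 m3 \<in> carrier_mat (m1 * m3) m3" by simp
  have o: "?o \<in> carrier_mat 1 m1" by simp
  have A: "calA m1 \<in> carrier_mat m1 m1" "mat_adjoint (calA m1) \<in> carrier_mat m1 m1" by simp_all
  have 1: "(calA m1 \<otimes>\<^sub>K 1\<^sub>m m3) * M22 m1 m2 m3 = calA m1 \<otimes>\<^sub>K mat_adjoint ?L"
    unfolding M22_eq
    using kron_mult_kron[OF A(1) one_carrier_mat one_carrier_mat L] right_mult_one_mat[OF A(1)]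
      left_mult_one_mat[OF L] by simp
  have 2: "M22 m1 m2 m3 * mat_adjoint (A1 m1 m2 m3) = mat_adjoint (calA m1) \<otimes>\<^sub>K mat_adjoint ?L"
    unfolding M22_eq A1_eq mat_adjoint_kron[of "calA m1"] mat_adjoint_one
    using kron_mult_kron[OF one_carrier_mat L A(2) one_carrier_mat] left_mult_one_mat[OF A(2)]
      right_mult_one_mat[OF L] by simp
  have "mat_adjoint ?L * M21 m1 m2 m3 = (1\<^sub>m 1 \<otimes>\<^sub>K mat_adjoint ?L) * (?o \<otimes>\<^sub>K 1\<^sub>m ?m)"
    by (simp add: M21_def one1_kron)
  also have "\<dots> = ?o \<otimes>\<^sub>K mat_adjoint ?L"
    using kron_mult_kron[OF one_carrier_mat L o one_carrier_mat] left_mult_one_mat[OF o]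
      right_mult_one_mat[OF L] by simp
  finally have "Lcol m1 m3 * mat_adjoint ?L * M21 m1 m2 m3 = (ones m1 \<otimes>\<^sub>K 1\<^sub>m m3) * (?o \<otimes>\<^sub>K mat_adjoint ?L)"
    using assoc_mult_mat[OF L1 L M_carriers(2)] by (simp add: Lcol_def)
  also have "\<dots> = (ones m1 * ?o) \<otimes>\<^sub>K mat_adjoint ?L"
    using kron_mult_kron[OF ones_carrier(1) one_carrier_mat o L] left_mult_one_mat[OF L] by simp
  finally have 3: "Lcol m1 m3 * mat_adjoint ?L * M21 m1 m2 m3 = (ones m1 * ?o) \<otimes>\<^sub>K mat_adjoint ?L" .
  show ?thesis
    unfolding 1 2 3 kron_minus_left[OF A, symmetric] calA_minus_adjoint kron_smult_left ..
qed

text \<open>\<open>M42\<close> is itself block Toeplitz, with wide blocks, and its own half sums are by definition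
  \<open>K11\<close> and \<open>Kmat\<close>.\<close>

lemma intertwine42:
  "(calA m1 \<otimes>\<^sub>K 1\<^sub>m m3) * M42 m1 m2 m3 t - M42 m1 m2 m3 t * mat_adjoint (A1 m1 m2 m3) =
   \<i> \<cdot>\<^sub>m (K11 m1 m2 m3 t * M21 m1 m2 m3 + Lcol m1 m3 * Kmat m1 m2 m3 t)"
  unfolding A1_eq M42_def M21_def K11_def Kmat_def Lcol_def mat_adjoint_kron mat_adjoint_one
  by (rule toeplitz_identity) simp

section \<open>The resolvents applied to the column of identities\<close>

text \<open>Both resolvents and the column of identities split along the Kronecker slots, so the product is a
  pure tensor with one factor for each variable.\<close>

lemma res_prod_Lcol:
  assumes l1: "l1 \<noteq> \<i> / 2" and l2: "l2 \<noteq> \<i> / 2"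
  shows "res_prod m1 m2 m3 l1 l2 * Lcol (m1 * m2) m3 =
    resolved_ones m1 l1 \<otimes>\<^sub>K (resolved_ones m2 l2 \<otimes>\<^sub>K 1\<^sub>m m3)"
    and "res_prod m1 m2 m3 l1 l2 \<in> carrier_mat (m1 * (m2 * m3)) (m1 * (m2 * m3))"
proof -
  note R1 = resolvent_props[OF calA_carrier det_calA_minus[OF l1], of m1]
  note R2 = resolvent_props[OF calA_carrier det_calA_minus[OF l2], of m2]
  let ?R1 = "resolvent (calA m1) l1" and ?R2 = "resolvent (calA m2) l2"
  let ?m = "m2 * m3"
  have D: "calA m2 \<otimes>\<^sub>K 1\<^sub>m m3 \<in> carrier_mat ?m ?m" by simp
  have det: "det (calA m2 \<otimes>\<^sub>K 1\<^sub>m m3 - l2 \<cdot>\<^sub>m 1\<^sub>m ?m) \<noteq> 0"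
  proof -
    have c: "calA m2 - l2 \<cdot>\<^sub>m 1\<^sub>m m2 \<in> carrier_mat m2 m2" by (simp add: minus_carrier_mat)
    have "(calA m2 \<otimes>\<^sub>K 1\<^sub>m m3 - l2 \<cdot>\<^sub>m 1\<^sub>m ?m) * (?R2 \<otimes>\<^sub>K 1\<^sub>m m3) = 1\<^sub>m ?m"
      using kron_mult_kron[OF c one_carrier_mat R2(1) one_carrier_mat] R2(2)
      by (simp add: shift_kron_one one_kron_one)
    then have "det (calA m2 \<otimes>\<^sub>K 1\<^sub>m m3 - l2 \<cdot>\<^sub>m 1\<^sub>m ?m) * det (?R2 \<otimes>\<^sub>K 1\<^sub>m m3) = 1"
      using det_mult[of "calA m2 \<otimes>\<^sub>K 1\<^sub>m m3 - l2 \<cdot>\<^sub>m 1\<^sub>m ?m" ?m "?R2 \<otimes>\<^sub>K 1\<^sub>m m3"] R2(1)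
      by (simp add: minus_carrier_mat)
    then show ?thesis by auto
  qed
  have R2': "?R2 \<otimes>\<^sub>K 1\<^sub>m m3 \<in> carrier_mat ?m ?m" using R2 by simp
  have "res_prod m1 m2 m3 l1 l2 = (?R1 \<otimes>\<^sub>K 1\<^sub>m ?m) * (1\<^sub>m m1 \<otimes>\<^sub>K (?R2 \<otimes>\<^sub>K 1\<^sub>m m3))"
    by (simp add: res_prod_def A1_eq A2_eq resolvent_kron_one[OF calA_carrier det_calA_minus[OF l1]]
        resolvent_one_kron[OF D det] resolvent_kron_one[OF calA_carrier det_calA_minus[OF l2]])
  also have "\<dots> = ?R1 \<otimes>\<^sub>K (?R2 \<otimes>\<^sub>K 1\<^sub>m m3)"
    using kron_mult_kron[OF R1(1) one_carrier_mat one_carrier_mat R2'] right_mult_one_mat[OF R1(1)]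
      left_mult_one_mat[OF R2'] by simp
  finally have rp: "res_prod m1 m2 m3 l1 l2 = ?R1 \<otimes>\<^sub>K (?R2 \<otimes>\<^sub>K 1\<^sub>m m3)" .
  then show "res_prod m1 m2 m3 l1 l2 \<in> carrier_mat (m1 * ?m) (m1 * ?m)"
    using kron_carrier[OF R1(1) R2'] by simp
  have L2: "Lcol m2 m3 \<in> carrier_mat ?m m3" by simp
  have "res_prod m1 m2 m3 l1 l2 * Lcol (m1 * m2) m3 =
      (?R1 \<otimes>\<^sub>K (?R2 \<otimes>\<^sub>K 1\<^sub>m m3)) * (ones m1 \<otimes>\<^sub>K Lcol m2 m3)"
    by (simp add: rp Lcol_def ones_mult kron_assoc)
  also have "\<dots> = (?R1 * ones m1) \<otimes>\<^sub>K ((?R2 \<otimes>\<^sub>K 1\<^sub>m m3) * Lcol m2 m3)"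
    by (rule kron_mult_kron[OF R1(1) R2' ones_carrier(1) L2])
  also have "(?R2 \<otimes>\<^sub>K 1\<^sub>m m3) * Lcol m2 m3 = (?R2 * ones m2) \<otimes>\<^sub>K 1\<^sub>m m3"
    unfolding Lcol_def using kron_mult_kron[OF R2(1) one_carrier_mat ones_carrier(1) one_carrier_mat] by simp
  finally show "res_prod m1 m2 m3 l1 l2 * Lcol (m1 * m2) m3 =
    resolved_ones m1 l1 \<otimes>\<^sub>K (resolved_ones m2 l2 \<otimes>\<^sub>K 1\<^sub>m m3)"
    by (simp add: resolved_ones_def)
qed

lemma shift_tail:
  assumes "l \<noteq> \<i> / 2"
  shows "((calA n \<otimes>\<^sub>K 1\<^sub>m m3) - l \<cdot>\<^sub>m 1\<^sub>m (n * m3)) * (resolved_ones n l \<otimes>\<^sub>K 1\<^sub>m m3) = Lcol n m3"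
proof -
  note r = resolved_ones[OF assms, of n]
  have c: "calA n - l \<cdot>\<^sub>m 1\<^sub>m n \<in> carrier_mat n n" by (simp add: minus_carrier_mat)
  show ?thesis
    using kron_mult_kron[OF c one_carrier_mat r(1) one_carrier_mat]
    by (simp add: shift_kron_one r(2) Lcol_def)
qed

text \<open>\<open>shift1\<close> and \<open>shift2\<close> are where the correction term in \<open>uhat\<close> comes from: cancelling one of the
  two resolvents leaves a right multiple of the block \<open>M31\<close> or \<open>M32\<close> of \<open>Pi\<close>, and up to the factor \<open>\<i>\<close>
  the multiplier is what \<open>u_tail\<close> contributes in the variable of the remaining resolvent.\<close>

lemma shift1:
  assumes l1: "l1 \<noteq> \<i> / 2" and l2: "l2 \<noteq> \<i> / 2"
  shows "(A1 m1 m2 m3 - l1 \<cdot>\<^sub>m 1\<^sub>m (m1 * (m2 * m3))) * (res_prod m1 m2 m3 l1 l2 * Lcol (m1 * m2) m3) =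
    M31 m1 m2 m3 * (resolved_ones m2 l2 \<otimes>\<^sub>K 1\<^sub>m m3)"
proof -
  note r1 = resolved_ones[OF l1, of m1] and r2 = resolved_ones[OF l2, of m2]
  let ?X = "resolved_ones m2 l2 \<otimes>\<^sub>K 1\<^sub>m m3"
  have X: "?X \<in> carrier_mat (m2 * m3) m3" using kron_carrier[OF r2(1) one_carrier_mat, of m3] by simp
  have c: "calA m1 - l1 \<cdot>\<^sub>m 1\<^sub>m m1 \<in> carrier_mat m1 m1" by (simp add: minus_carrier_mat)
  have "(A1 m1 m2 m3 - l1 \<cdot>\<^sub>m 1\<^sub>m (m1 * (m2 * m3))) * (res_prod m1 m2 m3 l1 l2 * Lcol (m1 * m2) m3) =
      ones m1 \<otimes>\<^sub>K ?X"
    unfolding res_prod_Lcol(1)[OF l1 l2] A1_eq shift_kron_one[OF calA_carrier]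
    using kron_mult_kron[OF c one_carrier_mat r1(1) X] r1(2) left_mult_one_mat[OF X] by simp
  also have "\<dots> = (ones m1 \<otimes>\<^sub>K 1\<^sub>m (m2 * m3)) * (1\<^sub>m 1 \<otimes>\<^sub>K ?X)"
    using kron_mult_kron[OF ones_carrier(1) one_carrier_mat one_carrier_mat X]
      right_mult_one_mat[OF ones_carrier(1)] left_mult_one_mat[OF X] by simp
  finally show ?thesis by (simp add: M31_eq one1_kron)
qed

lemma shift2:
  assumes l1: "l1 \<noteq> \<i> / 2" and l2: "l2 \<noteq> \<i> / 2"
  shows "(A2 m1 m2 m3 - l2 \<cdot>\<^sub>m 1\<^sub>m (m1 * (m2 * m3))) * (res_prod m1 m2 m3 l1 l2 * Lcol (m1 * m2) m3) =
    M32 m1 m2 m3 * (resolved_ones m1 l1 \<otimes>\<^sub>K 1\<^sub>m m3)"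
proof -
  note r1 = resolved_ones[OF l1, of m1] and r2 = resolved_ones[OF l2, of m2]
  let ?D = "calA m2 \<otimes>\<^sub>K 1\<^sub>m m3" and ?X = "resolved_ones m2 l2 \<otimes>\<^sub>K 1\<^sub>m m3"
  have D: "?D \<in> carrier_mat (m2 * m3) (m2 * m3)" by simp
  then have c: "?D - l2 \<cdot>\<^sub>m 1\<^sub>m (m2 * m3) \<in> carrier_mat (m2 * m3) (m2 * m3)"
    by (simp add: minus_carrier_mat)
  have X: "?X \<in> carrier_mat (m2 * m3) m3" using kron_carrier[OF r2(1) one_carrier_mat, of m3] by simp
  have L: "Lcol m2 m3 \<in> carrier_mat (m2 * m3) m3" by simp
  have "(A2 m1 m2 m3 - l2 \<cdot>\<^sub>m 1\<^sub>m (m1 * (m2 * m3))) * (res_prod m1 m2 m3 l1 l2 * Lcol (m1 * m2) m3) =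
      resolved_ones m1 l1 \<otimes>\<^sub>K Lcol m2 m3"
    unfolding res_prod_Lcol(1)[OF l1 l2] A2_eq shift_one_kron[OF D]
    using kron_mult_kron[OF one_carrier_mat c r1(1) X] shift_tail[OF l2] left_mult_one_mat[OF r1(1)]
    by simp
  also have "\<dots> = M32 m1 m2 m3 * (resolved_ones m1 l1 \<otimes>\<^sub>K 1\<^sub>m m3)"
    unfolding M32_eq
    using kron_mult_kron[OF one_carrier_mat L r1(1) one_carrier_mat] left_mult_one_mat[OF r1(1)]
      right_mult_one_mat[OF L] by simp
  finally show ?thesis .
qed

lemma u_tail_eq:
  assumes "l \<noteq> \<i> / 2"
  shows "u_tail n m3 l = 0\<^sub>m (n * m3) m3 @\<^sub>r \<i> \<cdot>\<^sub>m (resolved_ones n l \<otimes>\<^sub>K 1\<^sub>m m3)"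
proof -
  let ?X = "resolved_ones n l \<otimes>\<^sub>K 1\<^sub>m m3" and ?k = "n * m3"
  have X: "?X \<in> carrier_mat ?k m3"
    using kron_carrier[OF resolved_ones(1)[OF assms, of n] one_carrier_mat, of m3] by simp
  have "u_tail n m3 l = \<i> \<cdot>\<^sub>m ((0\<^sub>m ?k ?k @\<^sub>r 1\<^sub>m ?k) * ?X)"
    by (simp add: u_tail_def resolved_ones_def)
  also have "(0\<^sub>m ?k ?k @\<^sub>r 1\<^sub>m ?k) * ?X = 0\<^sub>m ?k m3 @\<^sub>r ?X"
    using append_rows_mult[OF zero_carrier_mat one_carrier_mat X] left_mult_zero_mat[OF X]
      left_mult_one_mat[OF X] by simp
  finally show ?thesis using append_rows_smult[OF zero_carrier_mat X] by (simp add: smult_zero_mat)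
qed

section \<open>The linear equation and its solution\<close>

lemma inverse_TBT:
  assumes "invertible_mat (TBT m1 m2 m3 t)"
  shows "Rmat m1 m2 m3 t \<in> carrier_mat (m1 * (m2 * m3)) (m1 * (m2 * m3))"
    "Rmat m1 m2 m3 t * TBT m1 m2 m3 t = 1\<^sub>m (m1 * (m2 * m3))"
    "TBT m1 m2 m3 t * Rmat m1 m2 m3 t = 1\<^sub>m (m1 * (m2 * m3))"
proof -
  let ?T = "TBT m1 m2 m3 t" and ?n = "m1 * (m2 * m3)"
  have T: "?T \<in> carrier_mat ?n ?n" by simp
  obtain B where B: "?T * B = 1\<^sub>m ?n" "B * ?T = 1\<^sub>m (dim_row B)"
    using assms T unfolding invertible_mat_def inverts_mat_def by auto
  have "B \<in> carrier_mat ?n ?n"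
    using arg_cong[OF B(1), of dim_col] arg_cong[OF B(2), of dim_col] T by auto
  then have "det ?T * det B = 1" using det_mult[OF T] B(1) by (metis det_one)
  then have "det ?T \<noteq> 0" by auto
  from minv[OF T this] show "Rmat m1 m2 m3 t \<in> carrier_mat ?n ?n"
    "Rmat m1 m2 m3 t * ?T = 1\<^sub>m ?n" "?T * Rmat m1 m2 m3 t = 1\<^sub>m ?n"
    by (auto simp: Rmat_def)
qed

lemma G_mult_uhat:
  assumes t: "\<And>r s. \<bar>r\<bar> < int m1 \<Longrightarrow> \<bar>s\<bar> < int m2 \<Longrightarrow> t r s \<in> carrier_mat m3 m3"
    and inv: "invertible_mat (TBT m1 m2 m3 t)" and l1: "l1 \<noteq> \<i> / 2" and l2: "l2 \<noteq> \<i> / 2"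
  shows "G m1 m2 m3 t l1 l2 \<in> carrier_mat (2 * (m2 * m3) + 2 * (m1 * m3)) (2 * (m2 * m3) + 2 * (m1 * m3))"
    and "uhat m1 m2 m3 t l1 l2 \<in> carrier_mat (2 * (m2 * m3) + 2 * (m1 * m3)) m3"
    and "theta m1 m2 m3 t l1 l2 \<in> carrier_mat m3 m3"
    and "G m1 m2 m3 t l1 l2 * uhat m1 m2 m3 t l1 l2 =
      (0\<^sub>m (m2 * m3) m3 @\<^sub>r Lcol m2 m3 @\<^sub>r 0\<^sub>m (m1 * m3) m3 @\<^sub>r Lcol m1 m3) * theta m1 m2 m3 t l1 l2"
proof -
  define n a1 a2 where n: "n = m1 * (m2 * m3)" and a1: "a1 = m1 * m3" and a2: "a2 = m2 * m3"
  define R where "R = Rmat m1 m2 m3 t"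
  define S where "S = res_prod m1 m2 m3 l1 l2"
  define L where "L = Lcol (m1 * m2) m3"
  define V where "V = S * L"
  define X1 where "X1 = resolved_ones m1 l1 \<otimes>\<^sub>K 1\<^sub>m m3"
  define X2 where "X2 = resolved_ones m2 l2 \<otimes>\<^sub>K 1\<^sub>m m3"
  define D1 where "D1 = calA m1 \<otimes>\<^sub>K 1\<^sub>m m3"
  define D2 where "D2 = calA m2 \<otimes>\<^sub>K 1\<^sub>m m3"
  define th where "th = \<i> \<cdot>\<^sub>m (1\<^sub>m m3 + Kmat m1 m2 m3 t * (R * V))"
  note m = mult_carrier_mat
  have M: "M11 m1 m2 m3 t \<in> carrier_mat n a2" "M21 m1 m2 m3 \<in> carrier_mat a2 n"
    "M31 m1 m2 m3 \<in> carrier_mat n a2" "M41 m1 m2 m3 t \<in> carrier_mat a2 n"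
    "M12 m1 m2 m3 t \<in> carrier_mat n a1" "M22 m1 m2 m3 \<in> carrier_mat a1 n"
    "M32 m1 m2 m3 \<in> carrier_mat n a1" "M42 m1 m2 m3 t \<in> carrier_mat a1 n"
    "K11 m1 m2 m3 t \<in> carrier_mat a1 a2" "K12 m1 m2 m3 t \<in> carrier_mat a2 a1"
    "Kmat m1 m2 m3 t \<in> carrier_mat m3 n"
    "A1 m1 m2 m3 \<in> carrier_mat n n" "A2 m1 m2 m3 \<in> carrier_mat n n" "TBT m1 m2 m3 t \<in> carrier_mat n n"
    by (simp_all add: n a1 a2)
  note adj = mat_adjoint_carrier[OF M(12)] mat_adjoint_carrier[OF M(13)]
  note R = inverse_TBT[OF inv, folded n R_def]
  have S: "S \<in> carrier_mat n n" using res_prod_Lcol(2)[OF l1 l2] by (simp add: S_def n)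
  have L: "L \<in> carrier_mat n m3" using Lcol_carrier[of "m1 * m2" m3] by (simp add: L_def n mult.assoc)
  have L12: "Lcol m1 m3 \<in> carrier_mat a1 m3" "Lcol m2 m3 \<in> carrier_mat a2 m3" by (simp_all add: a1 a2)
  have V: "V \<in> carrier_mat n m3" unfolding V_def by (rule m[OF S L])
  have Z: "R * V \<in> carrier_mat n m3" by (rule m[OF R(1) V])
  have X: "X1 \<in> carrier_mat a1 m3" "X2 \<in> carrier_mat a2 m3"
    using kron_carrier[OF resolved_ones(1)[OF l1, of m1] one_carrier_mat[of m3]]
      kron_carrier[OF resolved_ones(1)[OF l2, of m2] one_carrier_mat[of m3]]
    by (simp_all add: X1_def X2_def a1 a2)
  have D: "D1 \<in> carrier_mat a1 a1" "D2 \<in> carrier_mat a2 a2" by (simp_all add: D1_def D2_def a1 a2)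
  have LL: "Lcol m1 m3 * mat_adjoint (Lcol m2 m3) \<in> carrier_mat a1 a2"
    "Lcol m2 m3 * mat_adjoint (Lcol m1 m3) \<in> carrier_mat a2 a1"
    using L12 by auto
  have th: "th \<in> carrier_mat m3 m3" unfolding th_def using m[OF M(11) Z] by simp
  \<comment> \<open>\<open>vhat\<close> and \<open>theta\<close> are written with the products bracketed to the left; all of them contain
    the same column \<open>R * V\<close>.\<close>
  have RSL: "(M * R * S) * L = M * (R * V)" if "M \<in> carrier_mat k n" for M k
    using assoc_mult_mat[OF m[OF that R(1)] S L] assoc_mult_mat[OF that R(1) V] by (simp add: V_def)
  have th_eq: "theta m1 m2 m3 t l1 l2 = th"
    using RSL[OF M(11)] by (simp add: theta_def th_def R_def S_def L_def)
  show "theta m1 m2 m3 t l1 l2 \<in> carrier_mat m3 m3"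
    using th by (simp add: th_eq)
  have stack: "(A @\<^sub>r B) * (R * V) + (0\<^sub>m b m3 @\<^sub>r \<i> \<cdot>\<^sub>m Y) = A * (R * V) @\<^sub>r (B * (R * V) + \<i> \<cdot>\<^sub>m Y)"
    if "A \<in> carrier_mat b n" "B \<in> carrier_mat b n" "Y \<in> carrier_mat b m3" for A B Y b
    using append_rows_mult[OF that(1,2) Z] that m[OF that(1) Z] m[OF that(2) Z]
      append_rows_add[OF m[OF that(1) Z] m[OF that(2) Z] zero_carrier_mat, of "\<i> \<cdot>\<^sub>m Y"] by simp
  define u1 where "u1 = M21 m1 m2 m3 * (R * V) @\<^sub>r (M41 m1 m2 m3 t * (R * V) + \<i> \<cdot>\<^sub>m X2)"
  define u2 where "u2 = M22 m1 m2 m3 * (R * V) @\<^sub>r (M42 m1 m2 m3 t * (R * V) + \<i> \<cdot>\<^sub>m X1)"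
  have uh1: "uhat1 m1 m2 m3 t l1 l2 = u1"
    unfolding u1_def stack[OF M(2,4) X(2), symmetric]
    using RSL[OF carrier_append_rows[OF M(2,4)]] u_tail_eq[OF l2, of m2]
    by (simp add: uhat1_def vhat1_def Gammahat1_def Pihat1_def R_def S_def L_def X2_def a2)
  have uh2: "uhat2 m1 m2 m3 t l1 l2 = u2"
    unfolding u2_def stack[OF M(6,8) X(1), symmetric]
    using RSL[OF carrier_append_rows[OF M(6,8)]] u_tail_eq[OF l1, of m1]
    by (simp add: uhat2_def vhat2_def Gammahat2_def Pihat2_def R_def S_def L_def X1_def a1)
  have u: "u1 \<in> carrier_mat (a2 + a2) m3" "u2 \<in> carrier_mat (a1 + a1) m3"
    unfolding u1_def u2_def using m[OF M(2) Z] m[OF M(4) Z] m[OF M(6) Z] m[OF M(8) Z] X by auto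
  show "uhat m1 m2 m3 t l1 l2 \<in> carrier_mat (2 * (m2 * m3) + 2 * (m1 * m3)) m3"
    unfolding uhat_def uh1 uh2 using carrier_append_rows[OF u] by (simp add: a1 a2 mult_2)
  have Gd1: "Gdiag m1 m3 l1 = four_block_mat (D1 - l1 \<cdot>\<^sub>m 1\<^sub>m a1) (0\<^sub>m a1 a1) (0\<^sub>m a1 a1) (D1 - l1 \<cdot>\<^sub>m 1\<^sub>m a1)"
    by (simp add: Gdiag_def Let_def D1_def a1 shift_kron_one)
  have Gd2: "Gdiag m2 m3 l2 = four_block_mat (D2 - l2 \<cdot>\<^sub>m 1\<^sub>m a2) (0\<^sub>m a2 a2) (0\<^sub>m a2 a2) (D2 - l2 \<cdot>\<^sub>m 1\<^sub>m a2)"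
    by (simp add: Gdiag_def Let_def D2_def a2 shift_kron_one)
  have Gd: "Gdiag m1 m3 l1 \<in> carrier_mat (a1 + a1) (a1 + a1)" "Gdiag m2 m3 l2 \<in> carrier_mat (a2 + a2) (a2 + a2)"
    by (simp_all add: Gd1 Gd2 minus_carrier_mat)
  have G12: "G12 m1 m2 m3 t = \<i> \<cdot>\<^sub>m ((M21 m1 m2 m3 @\<^sub>r M41 m1 m2 m3 t) * (R * (M12 m1 m2 m3 t @\<^sub>c M32 m1 m2 m3)) -
      four_block_mat (Lcol m2 m3 * mat_adjoint (Lcol m1 m3)) (0\<^sub>m a2 a1) (K12 m1 m2 m3 t) (0\<^sub>m a2 a1))"
    by (simp add: G12_def Pihat1_def Gamma2_def Pi2_def R_def a1 a2)
  have G21: "G21 m1 m2 m3 t = \<i> \<cdot>\<^sub>m ((M22 m1 m2 m3 @\<^sub>r M42 m1 m2 m3 t) * (R * (M11 m1 m2 m3 t @\<^sub>c M31 m1 m2 m3)) -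
      four_block_mat (Lcol m1 m3 * mat_adjoint (Lcol m2 m3)) (0\<^sub>m a1 a2) (K11 m1 m2 m3 t) (0\<^sub>m a1 a2))"
    by (simp add: G21_def Pihat2_def Gamma1_def Pi1_def R_def a1 a2)
  have Gc: "G12 m1 m2 m3 t \<in> carrier_mat (a2 + a2) (a1 + a1)" "G21 m1 m2 m3 t \<in> carrier_mat (a1 + a1) (a2 + a2)"
    unfolding G12 G21 using LL
    by (auto intro!: smult_carrier_mat minus_carrier_mat)
  show "G m1 m2 m3 t l1 l2 \<in> carrier_mat (2 * (m2 * m3) + 2 * (m1 * m3)) (2 * (m2 * m3) + 2 * (m1 * m3))"
    unfolding G_def using four_block_carrier_mat[OF Gd(2,1)] by (simp add: a1 a2 mult_2)
  have d1: "A1 m1 m2 m3 * TBT m1 m2 m3 t - TBT m1 m2 m3 t * mat_adjoint (A1 m1 m2 m3) =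
      \<i> \<cdot>\<^sub>m (M11 m1 m2 m3 t * M21 m1 m2 m3 + M31 m1 m2 m3 * M41 m1 m2 m3 t)"
    by (rule displacement1)
  have d2: "A2 m1 m2 m3 * TBT m1 m2 m3 t - TBT m1 m2 m3 t * mat_adjoint (A2 m1 m2 m3) =
      \<i> \<cdot>\<^sub>m (M12 m1 m2 m3 t * M22 m1 m2 m3 + M32 m1 m2 m3 * M42 m1 m2 m3 t)"
    by (rule displacement2) (rule t)
  have i21: "D2 * M21 m1 m2 m3 - M21 m1 m2 m3 * mat_adjoint (A2 m1 m2 m3) =
      \<i> \<cdot>\<^sub>m (Lcol m2 m3 * mat_adjoint (Lcol m1 m3) * M22 m1 m2 m3)"
    unfolding D2_def by (rule intertwine21)
  have i41: "D2 * M41 m1 m2 m3 t - M41 m1 m2 m3 t * mat_adjoint (A2 m1 m2 m3) =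
      \<i> \<cdot>\<^sub>m (K12 m1 m2 m3 t * M22 m1 m2 m3 + Lcol m2 m3 * Kmat m1 m2 m3 t)"
    unfolding D2_def by (rule intertwine41) (rule t)
  have i22: "D1 * M22 m1 m2 m3 - M22 m1 m2 m3 * mat_adjoint (A1 m1 m2 m3) =
      \<i> \<cdot>\<^sub>m (Lcol m1 m3 * mat_adjoint (Lcol m2 m3) * M21 m1 m2 m3)"
    unfolding D1_def by (rule intertwine22)
  have i42: "D1 * M42 m1 m2 m3 t - M42 m1 m2 m3 t * mat_adjoint (A1 m1 m2 m3) =
      \<i> \<cdot>\<^sub>m (K11 m1 m2 m3 t * M21 m1 m2 m3 + Lcol m1 m3 * Kmat m1 m2 m3 t)"
    unfolding D1_def by (rule intertwine42)
  have s1: "(A1 m1 m2 m3 - l1 \<cdot>\<^sub>m 1\<^sub>m n) * V = M31 m1 m2 m3 * X2"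
    unfolding n V_def S_def L_def X2_def by (rule shift1[OF l1 l2])
  have s2: "(A2 m1 m2 m3 - l2 \<cdot>\<^sub>m 1\<^sub>m n) * V = M32 m1 m2 m3 * X1"
    unfolding n V_def S_def L_def X1_def by (rule shift2[OF l1 l2])
  have t1: "(D1 - l1 \<cdot>\<^sub>m 1\<^sub>m a1) * X1 = Lcol m1 m3"
    unfolding D1_def X1_def a1 by (rule shift_tail[OF l1])
  have t2: "(D2 - l2 \<cdot>\<^sub>m 1\<^sub>m a2) * X2 = Lcol m2 m3"
    unfolding D2_def X2_def a2 by (rule shift_tail[OF l2])
  have top: "Gdiag m2 m3 l2 * u1 + G12 m1 m2 m3 t * u2 = 0\<^sub>m a2 m3 @\<^sub>r Lcol m2 m3 * th"
    unfolding Gd2 G12 u1_def u2_def th_def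
    by (rule displacement_block_row[OF M(13) adj(2) M(14) R M(5,7,6,8,2,4) D(2) LL(2) M(10) L12(2) M(11) V X
          d2 i21 i41 s2 t2])
  have bottom: "Gdiag m1 m3 l1 * u2 + G21 m1 m2 m3 t * u1 = 0\<^sub>m a1 m3 @\<^sub>r Lcol m1 m3 * th"
    unfolding Gd1 G21 u1_def u2_def th_def
    by (rule displacement_block_row[OF M(12) adj(1) M(14) R M(1,3,2,4,6,8) D(1) LL(1) M(9) L12(1) M(11) V X(2,1)
          d1 i22 i42 s1 t1])
  have "G m1 m2 m3 t l1 l2 * uhat m1 m2 m3 t l1 l2 =
      (Gdiag m2 m3 l2 * u1 + G12 m1 m2 m3 t * u2) @\<^sub>r (G21 m1 m2 m3 t * u1 + Gdiag m1 m3 l1 * u2)"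
    unfolding G_def uhat_def uh1 uh2
    by (rule four_block_mat_mult_append_rows[OF Gd(2) Gc Gd(1) u])
  also have "G21 m1 m2 m3 t * u1 + Gdiag m1 m3 l1 * u2 = Gdiag m1 m3 l1 * u2 + G21 m1 m2 m3 t * u1"
    using m[OF Gc(2) u(1)] m[OF Gd(1) u(2)] by (rule comm_add_mat)
  also have "(Gdiag m2 m3 l2 * u1 + G12 m1 m2 m3 t * u2) @\<^sub>r \<dots> =
      (0\<^sub>m a2 m3 @\<^sub>r Lcol m2 m3 * th) @\<^sub>r (0\<^sub>m a1 m3 @\<^sub>r Lcol m1 m3 * th)"
    unfolding top bottom ..
  also have "\<dots> = 0\<^sub>m a2 m3 @\<^sub>r (Lcol m2 m3 * th @\<^sub>r (0\<^sub>m a1 m3 @\<^sub>r Lcol m1 m3 * th))"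
    by (rule append_rows_assoc[OF zero_carrier_mat m[OF L12(2) th]
          carrier_append_rows[OF zero_carrier_mat m[OF L12(1) th]]])
  also have "\<dots> = (0\<^sub>m a2 m3 @\<^sub>r Lcol m2 m3 @\<^sub>r 0\<^sub>m a1 m3 @\<^sub>r Lcol m1 m3) * th"
    using append_rows_mult[OF zero_carrier_mat L12(1) th, of a1]
      append_rows_mult[OF L12(2) carrier_append_rows[OF zero_carrier_mat L12(1)] th, of a1]
      append_rows_mult[OF zero_carrier_mat
        carrier_append_rows[OF L12(2) carrier_append_rows[OF zero_carrier_mat L12(1)]] th, of a2 a1] th
    by simp
  finally show "G m1 m2 m3 t l1 l2 * uhat m1 m2 m3 t l1 l2 =
      (0\<^sub>m (m2 * m3) m3 @\<^sub>r Lcol m2 m3 @\<^sub>r 0\<^sub>m (m1 * m3) m3 @\<^sub>r Lcol m1 m3) * theta m1 m2 m3 t l1 l2"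
    by (simp add: th_eq a1 a2)
qed

theorem theorem3p1:
  fixes m1 m2 m3 :: nat
    and t :: "int \<Rightarrow> int \<Rightarrow> complex mat"
    and l1 l2 :: complex
  assumes "m1 \<ge> 2" and "m2 \<ge> 2" and "m3 \<ge> 2"
    and "\<And>r s. \<bar>r\<bar> < int m1 \<Longrightarrow> \<bar>s\<bar> < int m2 \<Longrightarrow> t r s \<in> carrier_mat m3 m3"
    and "invertible_mat (TBT m1 m2 m3 t)"
    and "l1 \<noteq> \<i> / 2" and "l2 \<noteq> \<i> / 2"
    and "det (G m1 m2 m3 t l1 l2) \<noteq> 0"
  shows "uhat m1 m2 m3 t l1 l2 =
    minv (G m1 m2 m3 t l1 l2)
    * (0\<^sub>m (m2 * m3) m3 @\<^sub>r (ones m2 \<otimes>\<^sub>K 1\<^sub>m m3) @\<^sub>r 0\<^sub>m (m1 * m3) m3 @\<^sub>r (ones m1 \<otimes>\<^sub>K 1\<^sub>m m3))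
    * theta m1 m2 m3 t l1 l2"
proof -
  let ?G = "G m1 m2 m3 t l1 l2" and ?u = "uhat m1 m2 m3 t l1 l2"
  let ?k = "2 * (m2 * m3) + 2 * (m1 * m3)"
  let ?c = "0\<^sub>m (m2 * m3) m3 @\<^sub>r Lcol m2 m3 @\<^sub>r 0\<^sub>m (m1 * m3) m3 @\<^sub>r Lcol m1 m3"
  note Gu = G_mult_uhat[of m1 m2 t m3 l1 l2, OF assms(4-7)]
  note G = minv[OF Gu(1) assms(8)]
  have c: "?c \<in> carrier_mat ?k m3"
    using carrier_append_rows[OF zero_carrier_mat[of "m2 * m3"] carrier_append_rows[OF Lcol_carrier[of m2]
        carrier_append_rows[OF zero_carrier_mat[of "m1 * m3"] Lcol_carrier[of m1]]]]
    by (simp add: mult_2 add.assoc)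
  have "?u = (minv ?G * ?G) * ?u" using G left_mult_one_mat[OF Gu(2)] by simp
  also have "\<dots> = minv ?G * (?G * ?u)" using G Gu(1,2) by (intro assoc_mult_mat) auto
  also have "\<dots> = minv ?G * (?c * theta m1 m2 m3 t l1 l2)" by (simp only: Gu(4))
  also have "\<dots> = minv ?G * ?c * theta m1 m2 m3 t l1 l2"
    using G c Gu(3) by (intro assoc_mult_mat[symmetric]) auto
  finally show ?thesis by (simp add: Lcol_def)
qed

end
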